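(* Let $\Bbbk$ be a countable totally ordered division ring, let $I$ and $J$ be countable sets with $I\subsetneq J$ and $J\setminus I$ infinite, let $K$ and $L$ be distributive $0$-lattices with $L$ countable and completely normal, let $\varphi\colon K\to L$ be a $0$-lattice homomorphism, and let $f\colon \mathrm{Op}^-(\Bbbk^{(I)},\Bbbk^{(I)})\to K$ be a $0$-lattice homomorphism. Then there exists a surjective lattice homomorphism $g\colon \mathrm{Op}^-(\Bbbk^{(J)},\Bbbk^{(J)})\twoheadrightarrow L$ such that $g\circ\varepsilon_{I,J}=\varphi\circ f$ on $\mathrm{Op}^-(\Bbbk^{(I)},\Bbbk^{(I)})$.
   Context: A totally ordered division ring is a division ring with a compatible total order. For a set $I$, $\Bbbk^{(I)}$ is the set of finitely supported maps $I\to\Bbbk$; it is regarded both as a right $\Bbbk$-vector space (the space of points) and as a left $\Bbbk$-vector space of functionals, each $a\in\Bbbk^{(I)}$ being identified with the functional $x\mapsto\sum_{i\in I}a_ix_i$ on $\Bbbk^{(I)}$. For $a\in\Bbbk^{(I)}$ put $[\![a>0]\!]=\{x\in\Bbbk^{(I)}:\sum_i a_ix_i>0\}$ and similarly $[\![a<0]\!]$. $\mathrm{Op}^-(\Bbbk^{(I)},\Bbbk^{(I)})$ is the sublattice of the powerset of $\Bbbk^{(I)}$ generated by all $[\![a>0]\!]$ and $[\![a<0]\!]$, $a\in\Bbbk^{(I)}$ (its least element is $\varnothing$). For $I\subseteq J$, $\Bbbk^{(I)}$ is identified with the set of elements of $\Bbbk^{(J)}$ with support in $I$, and $\varepsilon_{I,J}(X)=\{y\in\Bbbk^{(J)}: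 y\restriction_I\in X\}$ for $X\subseteq\Bbbk^{(I)}$; it maps $\mathrm{Op}^-(\Bbbk^{(I)},\Bbbk^{(I)})$ into $\mathrm{Op}^-(\Bbbk^{(J)},\Bbbk^{(J)})$. A distributive $0$-lattice $D$ is completely normal if for all $a,b\in D$ there exist $x,y\in D$ with $a\vee b=a\vee y=x\vee b$ and $x\wedge y=0$. *)

theory Defs
  imports "HOL-Library.Poly_Mapping" "HOL-Library.Countable_Set"
begin

text \<open>
  A totally ordered division ring is a type of sort
  \<open>{division_ring, linordered_ring_strict}\<close> (multiplication need not commute).
  The class \<open>linordered_ring_strict\<close> also carries an absolute value, which is
  determined by the order.
\<close>

text \<open>
  The space of finitely supported maps on \<open>I\<close>. As \<open>I\<close> ranges over the subsets of one
  index type, the identification of maps on \<open>I\<close> with the maps on \<open>J\<close>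
  supported in \<open>I \<subseteq> J\<close> is an inclusion.
\<close>

definition fin_supp :: "'i set \<Rightarrow> ('i \<Rightarrow>\<^sub>0 'k::zero) set" where
  "fin_supp I = {x. Poly_Mapping.keys x \<subseteq> I}"

lift_definition restrict_pm :: "'i set \<Rightarrow> ('i \<Rightarrow>\<^sub>0 'k::zero) \<Rightarrow> ('i \<Rightarrow>\<^sub>0 'k)"
  is "\<lambda>I x i. if i \<in> I then x i else 0"
  by (erule finite_subset[rotated]) auto

text \<open>Scalars of functionals stand on the left of coordinates of points.\<close>

definition pairing :: "('i \<Rightarrow>\<^sub>0 'k::semiring_0) \<Rightarrow> ('i \<Rightarrow>\<^sub>0 'k) \<Rightarrow> 'k" where
  "pairing a x = (\<Sum>i\<in>Poly_Mapping.keys a. Poly_Mapping.lookup a i * Poly_Mapping.lookup x i)"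

definition pos_half ::
    "('i \<Rightarrow>\<^sub>0 'k::{division_ring,linordered_ring_strict}) set \<Rightarrow> ('i \<Rightarrow>\<^sub>0 'k) \<Rightarrow> ('i \<Rightarrow>\<^sub>0 'k) set" where
  "pos_half E a = {x \<in> E. pairing a x > 0}"

definition neg_half ::
    "('i \<Rightarrow>\<^sub>0 'k::{division_ring,linordered_ring_strict}) set \<Rightarrow> ('i \<Rightarrow>\<^sub>0 'k) \<Rightarrow> ('i \<Rightarrow>\<^sub>0 'k) set" where
  "neg_half E a = {x \<in> E. pairing a x < 0}"

inductive_set gen_sublattice :: "'a::lattice set \<Rightarrow> 'a set" for G where
  gen: "x \<in> G \<Longrightarrow> x \<in> gen_sublattice G"
| sup: "x \<in> gen_sublattice G \<Longrightarrow> y \<in> gen_sublattice G \<Longrightarrow> sup x y \<in> gen_sublattice G"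
| inf: "x \<in> gen_sublattice G \<Longrightarrow> y \<in> gen_sublattice G \<Longrightarrow> inf x y \<in> gen_sublattice G"

text \<open>Points range over \<open>E\<close> and functionals over \<open>F\<close>.\<close>

definition Op_minus ::
    "('i \<Rightarrow>\<^sub>0 'k::{division_ring,linordered_ring_strict}) set \<Rightarrow> ('i \<Rightarrow>\<^sub>0 'k) set \<Rightarrow> ('i \<Rightarrow>\<^sub>0 'k) set set" where
  "Op_minus E F = gen_sublattice (pos_half E ` F \<union> neg_half E ` F)"

definition eps ::
    "'i set \<Rightarrow> 'i set \<Rightarrow> ('i \<Rightarrow>\<^sub>0 'k::zero) set \<Rightarrow> ('i \<Rightarrow>\<^sub>0 'k) set" where
  "eps I J X = {y \<in> fin_supp J. restrict_pm I y \<in> X}"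

text \<open>
  Homomorphisms out of a sublattice \<open>S\<close> of a lattice type; values outside \<open>S\<close> are irrelevant.
  The domain is often a lattice of sets, where \<open>sup\<close>, \<open>inf\<close> and
  \<open>bot\<close> are union, intersection and the empty set.
\<close>

definition lattice_hom_on :: "'a::lattice set \<Rightarrow> ('a \<Rightarrow> 'b::lattice) \<Rightarrow> bool" where
  "lattice_hom_on S h \<longleftrightarrow>
    (\<forall>x\<in>S. \<forall>y\<in>S. h (sup x y) = sup (h x) (h y) \<and> h (inf x y) = inf (h x) (h y))"

definition lattice0_hom_on ::
    "'a::bounded_lattice_bot set \<Rightarrow> ('a \<Rightarrow> 'b::bounded_lattice_bot) \<Rightarrow> bool" where
  "lattice0_hom_on S h \<longleftrightarrow> lattice_hom_on S h \<and> h bot = bot"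

class completely_normal_lattice = distrib_lattice + bounded_lattice_bot +
  assumes completely_normal:
    "\<exists>x y. sup a b = sup a y \<and> sup a y = sup x b \<and> inf x y = bot"

lemma lookup_restrict_pm:
  "Poly_Mapping.lookup (restrict_pm I x) i = (if i \<in> I then Poly_Mapping.lookup x i else 0)"
  by transfer simp

lemma empty_in_Op_minus: "{} \<in> Op_minus (fin_supp I) (fin_supp I)"
proof -
  have "pos_half (fin_supp I) 0 = {}" "0 \<in> fin_supp I"
    by (auto simp: pos_half_def pairing_def fin_supp_def)
  then show ?thesis
    unfolding Op_minus_def by (metis UnI1 gen_sublattice.gen image_eqI)
qed

lemma eps_Op_minus:
  assumes "I \<subseteq> J" "X \<in> Op_minus (fin_supp I) (fin_supp I)"
  shows "eps I J X \<in> Op_minus (fin_supp J) (fin_supp J)"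
  using assms(2) unfolding Op_minus_def
proof (induction rule: gen_sublattice.induct)
  case (gen X)
  have r: "restrict_pm I y \<in> fin_supp I" for y :: "'a \<Rightarrow>\<^sub>0 'b"
    by (auto simp: fin_supp_def in_keys_iff lookup_restrict_pm split: if_splits)
  have p: "pairing a (restrict_pm I y) = pairing a y" if "a \<in> fin_supp I" for a y :: "'a \<Rightarrow>\<^sub>0 'b"
    unfolding pairing_def using that
    by (intro sum.cong) (auto simp: fin_supp_def lookup_restrict_pm)
  from gen obtain a where a: "a \<in> fin_supp I"
      and X: "X = pos_half (fin_supp I) a \<or> X = neg_half (fin_supp I) a"
    by blast
  have "eps I J X = pos_half (fin_supp J) a \<or> eps I J X = neg_half (fin_supp J) a"
    using X by (auto simp: eps_def pos_half_def neg_half_def r p[OF a])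
  moreover have "a \<in> fin_supp J" using a assms(1) by (auto simp: fin_supp_def)
  ultimately show ?case by (intro gen_sublattice.gen) blast
next
  case (sup X Y)
  have "eps I J (sup X Y) = sup (eps I J X) (eps I J Y)" by (auto simp: eps_def)
  then show ?case using sup by (simp add: gen_sublattice.sup)
next
  case (inf X Y)
  have "eps I J (inf X Y) = inf (eps I J X) (eps I J Y)" by (auto simp: eps_def)
  then show ?case using inf by (simp add: gen_sublattice.inf)
qed

end

theory Submission
  imports Defs
begin

text \<open>
  A $0$-lattice homomorphism from the lattice generated by open half-spaces to \<open>L\<close> is the same thing as
  an \<open>L\<close>-valued total preorder on the space of functionals: a map \<open>p\<close>, where \<open>p a\<close> is the value at
  \<open>a > 0\<close>, with \<open>p (a + b) \<le> p a \<squnion> p b\<close>, \<open>p (c a) = p a\<close> for \<open>c > 0\<close> and \<open>p a \<sqinter> p (- a) = 0\<close>.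
  (That such a \<open>p\<close> induces a homomorphism is checked at prime filters of \<open>L\<close>, where \<open>p\<close> becomes an
  ordinary total preorder whose signs on finitely many functionals are realized by a point.)
  So one has to extend such a map from the functionals supported in \<open>I\<close> to those supported in \<open>J\<close>, one
  new basis vector \<open>e\<close> at a time. The values at \<open>u + e\<close> and \<open>- u - e\<close> are chosen successively for the
  countably many old functionals \<open>u\<close>; only finitely many inequalities constrain each choice, and
  complete normality of \<open>L\<close> solves them. The choice at \<open>u = 0\<close> is unconstrained, so the infinitely many
  new basis vectors can be used to reach every element of \<open>L\<close>.
\<close>

section \<open>Prime filters\<close>

text \<open>Membership in \<open>Q\<close> is a homomorphism to the two truth values that preserves
  \<open>bot\<close>, \<open>inf\<close> and \<open>sup\<close>; the equivalence for
  \<open>inf\<close> includes upward closure. The empty set is allowed and gives the constant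
  homomorphism.\<close>

definition prime_filter :: "'a::{lattice,bot} set \<Rightarrow> bool" where
  "prime_filter Q \<longleftrightarrow> bot \<notin> Q \<and>
    (\<forall>x y. inf x y \<in> Q \<longleftrightarrow> x \<in> Q \<and> y \<in> Q) \<and> (\<forall>x y. sup x y \<in> Q \<longleftrightarrow> x \<in> Q \<or> y \<in> Q)"

lemma prime_filterD:
  assumes "prime_filter Q"
  shows "bot \<notin> Q" "inf x y \<in> Q \<longleftrightarrow> x \<in> Q \<and> y \<in> Q" "sup x y \<in> Q \<longleftrightarrow> x \<in> Q \<or> y \<in> Q"
  using assms by (auto simp: prime_filter_def)

text \<open>By Zorn's lemma some filter containing \<open>a\<close> is maximal among those avoiding
  \<open>b\<close>; distributivity makes it prime.\<close>

lemma prime_filter_separates: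
  fixes a b :: "'a::{distrib_lattice,bounded_lattice_bot}"
  assumes "\<not> a \<le> b"
  shows "\<exists>Q. prime_filter Q \<and> a \<in> Q \<and> b \<notin> Q"
proof -
  define \<F> where "\<F> = {F. (\<forall>x\<in>F. \<forall>y\<ge>x. y \<in> F) \<and> (\<forall>x\<in>F. \<forall>y\<in>F. inf x y \<in> F) \<and> a \<in> F \<and> b \<notin> F}"
  have "\<exists>M\<in>\<F>. \<forall>X\<in>\<F>. M \<subseteq> X \<longrightarrow> X = M"
  proof (rule subset_Zorn_nonempty)
    have "{a..} \<in> \<F>" using assms by (auto simp: \<F>_def intro: order_trans)
    then show "\<F> \<noteq> {}" by blast
  next
    fix C assume C: "C \<noteq> {}" "subset.chain \<F> C"
    then have sub: "C \<subseteq> \<F>" and lin: "\<And>X Y. X \<in> C \<Longrightarrow> Y \<in> C \<Longrightarrow> X \<subseteq> Y \<or> Y \<subseteq> X"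
      by (auto simp: subset_chain_def)
    have F: "\<forall>x\<in>X. \<forall>y\<ge>x. y \<in> X" "\<And>x y. x \<in> X \<Longrightarrow> y \<in> X \<Longrightarrow> inf x y \<in> X" "a \<in> X" "b \<notin> X"
      if "X \<in> C" for X
      using that sub by (auto simp: \<F>_def)
    have "inf x y \<in> \<Union>C" if "x \<in> X" "X \<in> C" "y \<in> Y" "Y \<in> C" for x y X Y
      using lin[OF that(2,4)]
    proof
      assume "X \<subseteq> Y" then show ?thesis using F(2)[OF that(4)] that by blast
    next
      assume "Y \<subseteq> X" then show ?thesis using F(2)[OF that(2)] that by blast
    qed
    moreover have "a \<in> \<Union>C" "b \<notin> \<Union>C" using C(1) F(3,4) by auto
    moreover have "\<forall>x\<in>\<Union>C. \<forall>y\<ge>x. y \<in> \<Union>C" using F(1) by fast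
    ultimately show "\<Union>C \<in> \<F>" unfolding \<F>_def by blast
  qed
  then obtain M where M: "M \<in> \<F>" and max: "\<And>X. X \<in> \<F> \<Longrightarrow> M \<subseteq> X \<Longrightarrow> X = M" by blast
  have up: "\<And>x y. x \<in> M \<Longrightarrow> x \<le> y \<Longrightarrow> y \<in> M" and meet: "\<And>x y. x \<in> M \<Longrightarrow> y \<in> M \<Longrightarrow> inf x y \<in> M"
    and aM: "a \<in> M" and bM: "b \<notin> M"
    using M by (auto simp: \<F>_def)
  \<comment> \<open>Otherwise the filter \<open>X\<close> generated by \<open>M\<close> and
    \<open>x\<close> would still avoid \<open>b\<close>, against maximality.\<close>
  have ex: "\<exists>m\<in>M. inf m x \<le> b" if "x \<notin> M" for x
  proof (rule ccontr)
    assume *: "\<not> ?thesis"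
    define X where "X = {y. \<exists>m\<in>M. inf m x \<le> y}"
    have "inf y z \<in> X" if yz: "y \<in> X" "z \<in> X" for y z
    proof -
      obtain m n where "m \<in> M" "n \<in> M" "inf m x \<le> y" "inf n x \<le> z" using yz by (auto simp: X_def)
      moreover have "inf (inf m n) x = inf (inf m x) (inf n x)"
        by (simp add: ac_simps)
      ultimately have "inf m n \<in> M" "inf (inf m n) x \<le> inf y z"
        by (simp_all only: meet inf_mono)
      then show ?thesis unfolding X_def by blast
    qed
    moreover have "M \<subseteq> X" by (auto simp: X_def intro: le_infI1)
    moreover have "x \<in> X" using aM by (auto simp: X_def intro: bexI[of _ a])
    moreover have "\<forall>y\<in>X. \<forall>z\<ge>y. z \<in> X" unfolding X_def using order_trans by blast
    moreover have "b \<notin> X" using * by (simp add: X_def)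
    ultimately have "X \<in> \<F>" using aM unfolding \<F>_def by blast
    with \<open>M \<subseteq> X\<close> \<open>x \<in> X\<close> max that show False by blast
  qed
  have prime: "x \<in> M \<or> y \<in> M" if s: "sup x y \<in> M" for x y
  proof (rule ccontr)
    assume "\<not> ?thesis"
    then obtain m n where "m \<in> M" "n \<in> M" "inf m x \<le> b" "inf n y \<le> b" using ex by metis
    moreover have "inf (inf m n) (sup x y) \<le> sup (inf m x) (inf n y)"
      unfolding inf_sup_distrib1 by (intro sup_mono inf_mono) auto
    ultimately have "m \<in> M" "n \<in> M" "inf (inf m n) (sup x y) \<le> b"
      by (simp_all, meson le_sup_iff order_trans sup_least)
    then show False using s meet[of m n] meet[of "inf m n" "sup x y"] up bM by blast
  qed
  have "inf x y \<in> M \<longleftrightarrow> x \<in> M \<and> y \<in> M" for x y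
    using up[OF _ inf_le1] up[OF _ inf_le2] meet by blast
  moreover have "sup x y \<in> M \<longleftrightarrow> x \<in> M \<or> y \<in> M" for x y
    using up[OF _ sup_ge1] up[OF _ sup_ge2] prime by blast
  moreover have "bot \<notin> M" using up[of bot b] bM by auto
  ultimately have "prime_filter M" by (simp add: prime_filter_def)
  with aM bM show ?thesis by blast
qed

lemma le_iff_prime_filter:
  fixes a b :: "'a::{distrib_lattice,bounded_lattice_bot}"
  shows "a \<le> b \<longleftrightarrow> (\<forall>Q. prime_filter Q \<longrightarrow> a \<in> Q \<longrightarrow> b \<in> Q)"
proof
  assume "a \<le> b"
  then have "inf a b = a" by (rule inf_absorb1)
  then show "\<forall>Q. prime_filter Q \<longrightarrow> a \<in> Q \<longrightarrow> b \<in> Q" using prime_filterD(2)[of _ a b] by auto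
next
  assume "\<forall>Q. prime_filter Q \<longrightarrow> a \<in> Q \<longrightarrow> b \<in> Q"
  then show "a \<le> b" using prime_filter_separates[of a b] by blast
qed

lemma eq_bot_iff_prime_filter:
  fixes a :: "'a::{distrib_lattice,bounded_lattice_bot}"
  shows "a = bot \<longleftrightarrow> (\<forall>Q. prime_filter Q \<longrightarrow> a \<notin> Q)"
  using le_iff_prime_filter[of a bot] prime_filterD(1) by (auto simp: bot_unique)

text \<open>These rules turn a lattice inequality into a propositional statement about membership in
  an arbitrary prime filter.\<close>

lemmas prime_filter_simps = le_iff_prime_filter eq_bot_iff_prime_filter prime_filterD

section \<open>Solving finite systems in completely normal lattices\<close>

lemma completely_normal_disjoint:
  fixes a b :: "'a::completely_normal_lattice"
  obtains x y where "inf x y = bot" "a \<le> sup x b" "b \<le> sup a y"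
  using completely_normal[of a b] by (metis sup.cobounded1 sup.cobounded2)

lemma separate_pair:
  fixes A B C D :: "'a::completely_normal_lattice"
  assumes "A \<le> sup (sup B D) C'" "C \<le> sup (sup B D) A'" "inf A A' = bot" "inf C C' = bot"
  shows "\<exists>x y. inf x y = bot \<and> A \<le> sup x B \<and> C \<le> sup y D"
proof -
  obtain x y where xy: "inf x y = bot" "D \<le> sup x B" "B \<le> sup D y"
    by (rule completely_normal_disjoint)
  \<comment> \<open>The meet of the witnesses vanishes because \<open>C'\<close> is disjoint from
    \<open>C\<close>, \<open>A'\<close> from \<open>A\<close>, and \<open>x\<close> from
    \<open>y\<close>. The inequalities follow by replacing \<open>D\<close> with
    \<open>sup x B\<close> and \<open>B\<close> with \<open>sup D y\<close> in the
    hypotheses.\<close>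
  show ?thesis
    by (rule exI[of _ "inf A (sup x C')"], rule exI[of _ "inf C (sup y A')"])
      (use assms xy in \<open>simp add: prime_filter_simps; blast\<close>)
qed

lemma le_sup_sup:
  fixes a :: "'a::semilattice_sup"
  shows "a \<le> sup x b \<Longrightarrow> a \<le> sup (sup x y) b" "a \<le> sup y b \<Longrightarrow> a \<le> sup (sup x y) b"
  by (erule order_trans, simp add: le_supI1)+

text \<open>Pairwise solutions are glued in two rounds. For one pair of \<open>S\<close>, running
  through \<open>T\<close>, the \<open>x\<close> are met and the \<open>y\<close> joined; then,
  running through \<open>S\<close>, the \<open>x\<close> are joined and the \<open>y\<close> met. By
  distributivity a meet of solutions of a lower bound is again a solution.\<close>

lemma separate_finite:
  fixes S T :: "('a::{distrib_lattice,bounded_lattice_bot} \<times> 'a) set"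
  assumes "finite S" "finite T"
    and pairs: "\<And>A B C D. (A, B) \<in> S \<Longrightarrow> (C, D) \<in> T \<Longrightarrow>
      \<exists>x y. inf x y = bot \<and> A \<le> sup x B \<and> C \<le> sup y D"
  shows "\<exists>x y. inf x y = bot \<and> (\<forall>(A, B)\<in>S. A \<le> sup x B) \<and> (\<forall>(C, D)\<in>T. C \<le> sup y D)"
  using assms(1) pairs
proof (induction S)
  case empty
  have "\<exists>y. \<forall>(C, D)\<in>T. C \<le> sup y D" using \<open>finite T\<close>
  proof (induction T)
    case (insert q T)
    then obtain y where "\<forall>(C, D)\<in>T. C \<le> sup y D" by blast
    then have "\<forall>(C, D)\<in>insert q T. C \<le> sup (sup y (fst q)) D"
      by (auto simp: prime_filter_simps)
    then show ?case by blast
  qed auto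
  then obtain y where "\<forall>(C, D)\<in>T. C \<le> sup y D" by blast
  then show ?case by (intro exI[of _ bot] exI[of _ y]) simp
next
  case (insert q S)
  obtain A B where q: "q = (A, B)" by fastforce
  have "\<exists>x y. inf x y = bot \<and> A \<le> sup x B \<and> (\<forall>(C, D)\<in>T. C \<le> sup y D)"
    using \<open>finite T\<close> insert.prems[of A B, unfolded q, OF insertI1]
  proof (induction T)
    case empty
    then show ?case by (intro exI[of _ A] exI[of _ bot]) simp
  next
    case (insert r T)
    obtain x y where 1: "inf x y = bot" "A \<le> sup x B" "\<forall>(C, D)\<in>T. C \<le> sup y D"
      using insert.IH insert.prems by blast
    obtain C D where r: "r = (C, D)" by fastforce
    obtain x' y' where 2: "inf x' y' = bot" "A \<le> sup x' B" "C \<le> sup y' D"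
      using insert.prems r by blast
    have "inf (inf x x') (sup y y') = bot"
      using 1(1) 2(1) by (auto simp: prime_filter_simps)
    moreover have "A \<le> sup (inf x x') B" using 1(2) 2(2) by (simp add: sup_inf_distrib2)
    moreover have "\<forall>(C, D)\<in>insert r T. C \<le> sup (sup y y') D"
      using 1(3) 2(3) r by (auto intro: le_sup_sup)
    ultimately show ?case by blast
  qed
  then obtain x y where 1: "inf x y = bot" "A \<le> sup x B" "\<forall>(C, D)\<in>T. C \<le> sup y D" by blast
  obtain x' y' where 2: "inf x' y' = bot" "\<forall>(A, B)\<in>S. A \<le> sup x' B" "\<forall>(C, D)\<in>T. C \<le> sup y' D"
    using insert.IH insert.prems by blast
  have "inf (sup x x') (inf y y') = bot"
    using 1(1) 2(1) by (auto simp: prime_filter_simps)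
  moreover have "\<forall>(A, B)\<in>insert q S. A \<le> sup (sup x x') B"
    using 1(2) 2(2) q by (auto intro: le_sup_sup)
  moreover have "\<forall>(C, D)\<in>T. C \<le> sup (inf y y') D"
    using 1(3) 2(3) by (auto simp: sup_inf_distrib2)
  ultimately show ?case by blast
qed

text \<open>Used to impose upper bounds after lower bounds: when each upper bound itself solves the
  system \<open>S\<close>, so does the meet of \<open>x\<close> with all of them.\<close>

lemma shrink_below:
  fixes x :: "'a::{distrib_lattice,bounded_lattice_bot}"
  assumes "finite M" "\<forall>(A, B)\<in>S. A \<le> sup x B" "\<And>m. m \<in> M \<Longrightarrow> \<forall>(A, B)\<in>S. A \<le> sup m B"
  shows "\<exists>x'\<le>x. (\<forall>m\<in>M. x' \<le> m) \<and> (\<forall>(A, B)\<in>S. A \<le> sup x' B)"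
  using assms(1,3)
proof (induction M)
  case empty
  then show ?case using assms(2) by auto
next
  case (insert m M)
  then obtain x' where "x' \<le> x" "\<forall>m\<in>M. x' \<le> m" "\<forall>(A, B)\<in>S. A \<le> sup x' B" by auto
  moreover have "\<forall>(A, B)\<in>S. A \<le> sup m B" using insert.prems by auto
  ultimately show ?case
    by (intro exI[of _ "inf x' m"]) (auto simp: sup_inf_distrib2 intro: le_infI1)
qed

text \<open>
  Think of \<open>\<alpha> i\<close> and \<open>\<beta> i\<close> as the truth values of \<open>w i > s\<close> and \<open>w i < s\<close>, and of \<open>d i\<close> and
  \<open>e i\<close> as those of \<open>t > w i\<close> and \<open>t < w i\<close>; the new values compare \<open>t\<close> with \<open>s\<close>.
\<close>

lemma amalgamate_comparison:
  fixes \<alpha> \<beta> d e :: "'n \<Rightarrow> 'a::completely_normal_lattice"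
  assumes fin: "finite N"
    and disj: "\<And>i. i \<in> N \<Longrightarrow> inf (\<alpha> i) (\<beta> i) = bot" "\<And>i. i \<in> N \<Longrightarrow> inf (d i) (e i) = bot"
    and d: "\<And>i j. i \<in> N \<Longrightarrow> j \<in> N \<Longrightarrow> d i \<le> sup (sup (d j) (\<alpha> j)) (\<beta> i)"
    and e: "\<And>i j. i \<in> N \<Longrightarrow> j \<in> N \<Longrightarrow> e j \<le> sup (sup (e i) (\<alpha> j)) (\<beta> i)"
    and \<alpha>: "\<And>i j. i \<in> N \<Longrightarrow> j \<in> N \<Longrightarrow> \<alpha> i \<le> sup (sup (\<alpha> j) (e i)) (d j)"
    and \<beta>: "\<And>i j. i \<in> N \<Longrightarrow> j \<in> N \<Longrightarrow> \<beta> j \<le> sup (sup (\<beta> i) (e i)) (d j)"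
  shows "\<exists>x y. inf x y = bot \<and> (\<forall>i\<in>N.
    x \<le> sup (\<alpha> i) (d i) \<and> \<alpha> i \<le> sup x (e i) \<and> d i \<le> sup x (\<beta> i) \<and>
    y \<le> sup (\<beta> i) (e i) \<and> \<beta> i \<le> sup y (d i) \<and> e i \<le> sup y (\<alpha> i))"
proof -
  \<comment> \<open>\<open>S\<close> lists the lower bounds required of \<open>x\<close> and
    \<open>T\<close> those of \<open>y\<close>; the upper bounds are imposed at the end.\<close>
  define S where "S = (\<lambda>i. (d i, \<beta> i)) ` N \<union> (\<lambda>i. (\<alpha> i, e i)) ` N"
  define T where "T = (\<lambda>i. (\<beta> i, d i)) ` N \<union> (\<lambda>i. (e i, \<alpha> i)) ` N"
  have swap: "inf (\<beta> i) (\<alpha> i) = bot" "inf (e i) (d i) = bot" if "i \<in> N" for i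
    using disj that by (simp_all add: inf.commute)
  \<comment> \<open>In these four cases the explicit arguments of \<open>separate_pair\<close> are
    \<open>C'\<close> and \<open>A'\<close>, the opposite comparisons to \<open>C\<close> and
    \<open>A\<close>: \<alpha> is opposite to \<beta>, and \<open>d\<close> to
    \<open>e\<close>.\<close>
  have "\<exists>x y. inf x y = bot \<and> d i \<le> sup x (\<beta> i) \<and> \<beta> j \<le> sup y (d j)" if "i \<in> N" "j \<in> N" for i j
    by (rule separate_pair[of _ _ _ "\<alpha> j" _ "e i"])
      (use that d[of i j] \<beta>[of i j] disj swap in \<open>simp_all add: ac_simps\<close>)
  moreover have "\<exists>x y. inf x y = bot \<and> d i \<le> sup x (\<beta> i) \<and> e j \<le> sup y (\<alpha> j)" if "i \<in> N" "j \<in> N" for i j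
    by (rule separate_pair[of _ _ _ "d j" _ "e i"])
      (use that d[of i j] e[of i j] disj swap in \<open>simp_all add: ac_simps\<close>)
  moreover have "\<exists>x y. inf x y = bot \<and> \<alpha> i \<le> sup x (e i) \<and> \<beta> j \<le> sup y (d j)" if "i \<in> N" "j \<in> N" for i j
    by (rule separate_pair[of _ _ _ "\<alpha> j" _ "\<beta> i"])
      (use that \<alpha>[of i j] \<beta>[of i j] disj swap in \<open>simp_all add: ac_simps\<close>)
  moreover have "\<exists>x y. inf x y = bot \<and> \<alpha> i \<le> sup x (e i) \<and> e j \<le> sup y (\<alpha> j)" if "i \<in> N" "j \<in> N" for i j
    by (rule separate_pair[of _ _ _ "d j" _ "\<beta> i"])
      (use that \<alpha>[of i j] e[of i j] disj swap in \<open>simp_all add: ac_simps\<close>)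
  ultimately have "\<exists>x y. inf x y = bot \<and> (\<forall>(A, B)\<in>S. A \<le> sup x B) \<and> (\<forall>(C, D)\<in>T. C \<le> sup y D)"
    by (intro separate_finite) (auto simp: S_def T_def fin)
  then obtain x y where xy: "inf x y = bot" "\<forall>(A, B)\<in>S. A \<le> sup x B" "\<forall>(C, D)\<in>T. C \<le> sup y D"
    by blast
  \<comment> \<open>The hypotheses on \<open>d\<close> and \<alpha> say exactly that each upper
    bound for \<open>x\<close> satisfies all lower bounds in \<open>S\<close>; those on
    \<open>e\<close> and \<beta> do the same for \<open>y\<close>.\<close>
  have "\<exists>x'\<le>x. (\<forall>m\<in>(\<lambda>i. sup (\<alpha> i) (d i)) ` N. x' \<le> m) \<and> (\<forall>(A, B)\<in>S. A \<le> sup x' B)"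
    by (rule shrink_below) (use fin xy d \<alpha> in \<open>auto simp: S_def ac_simps\<close>)
  then obtain x' where x': "x' \<le> x" "\<forall>i\<in>N. x' \<le> sup (\<alpha> i) (d i)" "\<forall>(A, B)\<in>S. A \<le> sup x' B"
    by auto
  have "\<exists>y'\<le>y. (\<forall>m\<in>(\<lambda>i. sup (\<beta> i) (e i)) ` N. y' \<le> m) \<and> (\<forall>(A, B)\<in>T. A \<le> sup y' B)"
    by (rule shrink_below) (use fin xy e \<beta> in \<open>auto simp: T_def ac_simps\<close>)
  then obtain y' where y': "y' \<le> y" "\<forall>i\<in>N. y' \<le> sup (\<beta> i) (e i)" "\<forall>(A, B)\<in>T. A \<le> sup y' B"
    by auto
  have "inf x' y' = bot" using xy(1) x'(1) y'(1) by (metis bot.extremum_uniqueI inf_mono)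
  then show ?thesis using x' y' by (intro exI[of _ x'] exI[of _ y']) (auto simp: S_def T_def)
qed

section \<open>Finitely supported functionals over ordered division rings\<close>

lemma zero_less_one_ring: "(0::'k::{division_ring,linordered_ring_strict}) < 1"
  using zero_le_square[of "1::'k"] by (simp add: order.strict_iff_order)

lemma inverse_pos:
  fixes c :: "'k::{division_ring,linordered_ring_strict}"
  assumes "0 < c"
  shows "0 < inverse c"
proof -
  have "0 < c * inverse c" using assms zero_less_one_ring by simp
  then show ?thesis using assms by (metis zero_less_mult_iff less_asym)
qed

text \<open>The midpoint works: \<open>h\<close> is the inverse of \<open>1 + 1\<close>, and both
  endpoints are multiplied by it on the right.\<close>

lemma dense_between:
  fixes x y :: "'k::{division_ring,linordered_ring_strict}"
  assumes "x < y"
  shows "\<exists>z. x < z \<and> z < y"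
proof -
  have "(0::'k) < 1 + 1" using zero_less_one_ring by (rule add_pos_pos) (rule zero_less_one_ring)
  then obtain h :: 'k where h: "0 < h" "(1 + 1) * h = 1"
    using inverse_pos right_inverse by (metis less_irrefl)
  have half: "u * h + u * h = u" for u :: 'k
  proof -
    have "u * h + u * h = u * ((1 + 1) * h)" unfolding distrib_right distrib_left by simp
    then show ?thesis unfolding h(2) by simp
  qed
  have "x * h < y * h" using assms h(1) by (rule mult_strict_right_mono)
  then have "x < x * h + y * h" "x * h + y * h < y"
    using half[of x] half[of y] by (metis add_strict_left_mono, metis add_strict_right_mono)
  then show ?thesis by blast
qed

lemma between_finite:
  fixes A B :: "'k::{division_ring,linordered_ring_strict} set"
  assumes "finite A" "finite B" "\<And>a b. a \<in> A \<Longrightarrow> b \<in> B \<Longrightarrow> a < b"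
  shows "\<exists>c. (\<forall>a\<in>A. a < c) \<and> (\<forall>b\<in>B. c < b)"
proof -
  have sh: "u < u + 1" "u - 1 < u" for u :: 'k using zero_less_one_ring by simp_all
  consider "A = {}" "B = {}" | "A = {}" "B \<noteq> {}" | "A \<noteq> {}" "B = {}" | "A \<noteq> {}" "B \<noteq> {}" by blast
  then show ?thesis
  proof cases
    case 2
    then have "\<forall>b\<in>B. Min B - 1 < b" using assms(2) sh(2) by (meson Min_le less_le_trans)
    with 2 show ?thesis by auto
  next
    case 3
    then have "\<forall>a\<in>A. a < Max A + 1" using assms(1) sh(1) by (meson Max_ge le_less_trans)
    with 3 show ?thesis by auto
  next
    case 4
    then have "Max A < Min B" using assms by simp
    then obtain c where "Max A < c" "c < Min B" using dense_between by blast
    with 4 assms show ?thesis by auto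
  qed auto
qed

section \<open>Scaling, supports and the pairing\<close>

lift_definition scale_pm :: "'k::semiring_0 \<Rightarrow> ('i \<Rightarrow>\<^sub>0 'k) \<Rightarrow> ('i \<Rightarrow>\<^sub>0 'k)"
  is "\<lambda>c x i. c * x i"
  by (erule finite_subset[rotated]) auto

lemma lookup_scale_pm [simp]: "Poly_Mapping.lookup (scale_pm c x) i = c * Poly_Mapping.lookup x i"
  by transfer simp

lemma fin_supp_iff: "x \<in> fin_supp I \<longleftrightarrow> (\<forall>i. i \<notin> I \<longrightarrow> Poly_Mapping.lookup x i = 0)"
  by (auto simp: fin_supp_def in_keys_iff)

lemma fin_supp_closed [simp]:
  "0 \<in> fin_supp I"
  "x \<in> fin_supp I \<Longrightarrow> y \<in> fin_supp I \<Longrightarrow> x + y \<in> fin_supp I"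
  "restrict_pm I z \<in> fin_supp I"
  by (auto simp: fin_supp_iff lookup_add lookup_restrict_pm)

lemma fin_supp_closed_ring [simp]:
  fixes x y :: "'i \<Rightarrow>\<^sub>0 'k::ring"
  shows "- x \<in> fin_supp I \<longleftrightarrow> x \<in> fin_supp I"
  "x \<in> fin_supp I \<Longrightarrow> y \<in> fin_supp I \<Longrightarrow> x - y \<in> fin_supp I"
  "x \<in> fin_supp I \<Longrightarrow> scale_pm c x \<in> fin_supp I"
  by (auto simp: fin_supp_iff lookup_minus)

lemma fin_supp_mono: "x \<in> fin_supp I \<Longrightarrow> I \<subseteq> J \<Longrightarrow> x \<in> fin_supp J"
  by (auto simp: fin_supp_def)

lemma pairing_superset:
  assumes "finite S" "Poly_Mapping.keys a \<subseteq> S"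
  shows "pairing a x = (\<Sum>i\<in>S. Poly_Mapping.lookup a i * Poly_Mapping.lookup x i)"
  unfolding pairing_def using assms by (intro sum.mono_neutral_left) (auto simp: in_keys_iff)

lemma pairing_add_left: "pairing (a + b) x = pairing a x + pairing b x"
proof -
  let ?S = "Poly_Mapping.keys a \<union> Poly_Mapping.keys b"
  have "pairing (a + b) x = (\<Sum>i\<in>?S. Poly_Mapping.lookup (a + b) i * Poly_Mapping.lookup x i)"
    by (rule pairing_superset) (auto simp: in_keys_iff lookup_add)
  then show ?thesis
    by (simp add: pairing_superset[of ?S a] pairing_superset[of ?S b] lookup_add distrib_right sum.distrib)
qed

lemma pairing_minus_left: "pairing (- a) x = - pairing (a :: 'i \<Rightarrow>\<^sub>0 'k::ring) x"
  using pairing_add_left[of "- a" a x] by (simp add: eq_neg_iff_add_eq_0 pairing_def)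

lemma pairing_diff_left: "pairing (a - b) x = pairing a x - pairing (b :: 'i \<Rightarrow>\<^sub>0 'k::ring) x"
  using pairing_add_left[of a "- b" x] by (simp add: pairing_minus_left)

lemma pairing_scale_left:
  "pairing (scale_pm c a) x = c * pairing (a :: 'i \<Rightarrow>\<^sub>0 'k::ring) x"
proof -
  have "pairing (scale_pm c a) x
      = (\<Sum>i\<in>Poly_Mapping.keys a. Poly_Mapping.lookup (scale_pm c a) i * Poly_Mapping.lookup x i)"
    by (rule pairing_superset) (auto simp: in_keys_iff)
  then show ?thesis by (simp add: pairing_def sum_distrib_left mult.assoc)
qed

lemma pairing_restrict:
  assumes "a \<in> fin_supp I"
  shows "pairing a (restrict_pm I x) = pairing a x"
  unfolding pairing_def using assms
  by (intro sum.cong) (auto simp: fin_supp_def lookup_restrict_pm)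

lemma pairing_single_right:
  "pairing a (x + Poly_Mapping.single j c) = pairing a x + Poly_Mapping.lookup a j * c"
proof -
  have "(\<Sum>i\<in>Poly_Mapping.keys a. Poly_Mapping.lookup a i * Poly_Mapping.lookup (Poly_Mapping.single j c) i)
      = (\<Sum>i\<in>Poly_Mapping.keys a. if i = j then Poly_Mapping.lookup a j * c else 0)"
    by (intro sum.cong) (auto simp: lookup_single when_def)
  also have "\<dots> = Poly_Mapping.lookup a j * c" by (auto simp: in_keys_iff)
  finally show ?thesis by (simp add: pairing_def lookup_add distrib_left sum.distrib)
qed

lemma scale_pm_simps:
  fixes x y :: "'i \<Rightarrow>\<^sub>0 'k::ring"
  shows "scale_pm c (x + y) = scale_pm c x + scale_pm c y" "scale_pm c (x - y) = scale_pm c x - scale_pm c y"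
    "scale_pm c (- x) = - scale_pm c x" "scale_pm (- c) x = - scale_pm c x" "scale_pm c 0 = (0 :: 'i \<Rightarrow>\<^sub>0 'k)"
    "scale_pm c (scale_pm d x) = scale_pm (c * d) x"
    "scale_pm (c + d) x = scale_pm c x + scale_pm d x"
  by (auto intro!: poly_mapping_eqI simp: lookup_add lookup_minus distrib_left distrib_right
      right_diff_distrib mult.assoc)

lemma scale_pm_1 [simp]: "scale_pm 1 x = (x :: 'i \<Rightarrow>\<^sub>0 'k::division_ring)"
  by (auto intro!: poly_mapping_eqI)

text \<open>
  The sets \<open>P\<close> satisfying this predicate are the sets of strictly positive elements of the total
  preorders on the left vector space \<open>V\<close>.
\<close>

definition preorder_cone :: "('i \<Rightarrow>\<^sub>0 'k::{division_ring,linordered_ring_strict}) set \<Rightarrow> ('i \<Rightarrow>\<^sub>0 'k) set \<Rightarrow> bool" where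
  "preorder_cone V P \<longleftrightarrow>
    (\<forall>a\<in>V. \<forall>b\<in>V. a + b \<in> P \<longrightarrow> a \<in> P \<or> b \<in> P) \<and>
    (\<forall>a\<in>V. \<forall>c>0. scale_pm c a \<in> P \<longleftrightarrow> a \<in> P) \<and>
    (\<forall>a\<in>V. a \<in> P \<longrightarrow> - a \<notin> P)"

text \<open>Fourier--Motzkin elimination of the coordinate \<open>j\<close> in the induction step.\<close>

lemma preorder_cone_realized:
  fixes P :: "('i \<Rightarrow>\<^sub>0 'k::{division_ring,linordered_ring_strict}) set"
  assumes P: "preorder_cone (fin_supp J) P"
  assumes "finite K" "K \<subseteq> J" "finite F" "F \<subseteq> fin_supp K"
  shows "\<exists>x\<in>fin_supp K. \<forall>u\<in>F. (u \<in> P \<longleftrightarrow> 0 < pairing u x) \<and> (- u \<in> P \<longleftrightarrow> pairing u x < 0)"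
  using assms(2-)
proof (induction K arbitrary: F)
  case empty
  have "0 \<notin> P" using P fin_supp_closed(1)[of J] unfolding preorder_cone_def by force
  moreover have u0: "u = 0" if "u \<in> F" for u using empty that by (auto simp: fin_supp_def)
  ultimately have "u \<notin> P \<and> - u \<notin> P \<and> pairing u 0 = 0" if "u \<in> F" for u
    using u0[OF that] by (simp add: pairing_def)
  then show ?case by (intro bexI[of _ 0]) auto
next
  case (insert j K)
  have J: "x \<in> fin_supp J" if "x \<in> fin_supp (insert j K)" for x :: "'i \<Rightarrow>\<^sub>0 'k"
    using that insert.prems(1) by (rule fin_supp_mono)
  have KJ: "x \<in> fin_supp J" if "x \<in> fin_supp K" for x :: "'i \<Rightarrow>\<^sub>0 'k"
    using that insert.prems(1) by (auto intro: fin_supp_mono)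
  have add: "a \<in> P \<or> b \<in> P" if "a + b \<in> P" "a \<in> fin_supp J" "b \<in> fin_supp J" for a b
    using P that by (auto simp: preorder_cone_def)
  have scale: "scale_pm c a \<in> P \<longleftrightarrow> a \<in> P" if "a \<in> fin_supp J" "c > 0" for a c
    using P that by (auto simp: preorder_cone_def)
  have asym: "- a \<notin> P" if "a \<in> fin_supp J" "a \<in> P" for a
    using P that by (auto simp: preorder_cone_def)
  define e where "e = (Poly_Mapping.single j 1 :: 'i \<Rightarrow>\<^sub>0 'k)"
  have eJ: "e \<in> fin_supp J" using insert.prems(1) by (auto simp: fin_supp_iff e_def lookup_single when_def)
  \<comment> \<open>A functional with nonzero coefficient \<open>t u\<close> at \<open>j\<close> is
    \<open>t u\<close> times \<open>e + g u\<close>, with \<open>g u\<close> free of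
    \<open>j\<close>. Its sign thus depends on \<open>t u\<close> and on how the new coordinate
    compares with the threshold given by \<open>- g u\<close>.\<close>
  define t where "t u = Poly_Mapping.lookup u j" for u :: "'i \<Rightarrow>\<^sub>0 'k"
  define g where "g u = scale_pm (inverse (t u)) (restrict_pm K u)" for u
  have u_eq: "u = scale_pm (t u) (e + g u)" if "u \<in> F" "t u \<noteq> 0" for u
  proof (rule poly_mapping_eqI)
    fix i
    have "u \<in> fin_supp (insert j K)" using that insert.prems by auto
    then show "Poly_Mapping.lookup u i = Poly_Mapping.lookup (scale_pm (t u) (e + g u)) i"
      using that(2) insert.hyps(2)
      by (auto simp: lookup_add e_def g_def lookup_restrict_pm lookup_single when_def
          t_def fin_supp_iff distrib_left simp flip: mult.assoc)
  qed
  have gK [simp]: "g u \<in> fin_supp K" for u by (simp add: g_def)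
  define N where "N = {u \<in> F. t u \<noteq> 0}"
  \<comment> \<open>Besides the functionals free of \<open>j\<close>, the induction hypothesis must
    control the differences \<open>g u - g v\<close>, so that the thresholds at \<open>x\<close> are
    ordered as \<open>P\<close> prescribes.\<close>
  define F' where "F' = {u \<in> F. t u = 0} \<union> (\<lambda>(u, v). g u - g v) ` (N \<times> N)"
  have "finite F'" using insert.prems(2) by (simp add: F'_def N_def)
  moreover have "F' \<subseteq> fin_supp K"
    using insert.prems(3) by (auto simp: F'_def t_def fin_supp_iff subset_iff lookup_minus)
      (metis (full_types) fin_supp_iff gK)+
  ultimately obtain x where xK: "x \<in> fin_supp K"
    and x: "\<forall>u\<in>F'. (u \<in> P \<longleftrightarrow> 0 < pairing u x) \<and> (- u \<in> P \<longleftrightarrow> pairing u x < 0)"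
    using insert.IH[of F'] insert.prems(1) by auto
  have gg: "g u - g v \<in> P \<longleftrightarrow> pairing (g v) x < pairing (g u) x" if "u \<in> N" "v \<in> N" for u v
  proof -
    have "g u - g v \<in> F'" using that by (auto simp: F'_def)
    then show ?thesis using x by (auto simp: pairing_diff_left)
  qed
  define s where "s u = e + g u" for u
  have sJ [simp]: "s u \<in> fin_supp J" for u using eJ KJ by (simp add: s_def)
  have ss: "s u - s v = g u - g v" for u v by (simp add: s_def)
  have dec: "g u - g v + s v = s u" "g u - g v + - s u = - s v" for u v by (simp_all add: s_def)
  have lt: "g u - g v \<in> P" if "s u \<in> P" "s v \<notin> P" for u v
    using add[of "g u - g v" "s v", unfolded dec(1)] that KJ by auto
  have lt': "g u - g v \<in> P" if "- s v \<in> P" "- s u \<notin> P" for u v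
    using add[of "g u - g v" "- s u", unfolded dec(2)] that KJ by auto
  have "\<exists>c. \<forall>u\<in>N. (s u \<in> P \<longleftrightarrow> 0 < c + pairing (g u) x) \<and> (- s u \<in> P \<longleftrightarrow> c + pairing (g u) x < 0)"
  \<comment> \<open>If some \<open>s v\<close> is neutral, its threshold forces the new coordinate.
    Otherwise \<open>c\<close> is chosen strictly between the lower thresholds \<open>A\<close> and
    the upper thresholds \<open>B\<close>.\<close>
  proof (cases "\<exists>v\<in>N. s v \<notin> P \<and> - s v \<notin> P")
    case True
    then obtain v where v: "v \<in> N" "s v \<notin> P" "- s v \<notin> P" by blast
    have "(s u \<in> P \<longleftrightarrow> g u - g v \<in> P) \<and> (- s u \<in> P \<longleftrightarrow> g v - g u \<in> P)" for u
      using lt[of u v] lt'[of u v] add[of "s u" "- s v"] add[of "s v" "- s u"] v lt'[of v u] lt[of v u] KJ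
      by (auto simp: ss)
    with v(1) show ?thesis
      by (intro exI[of _ "- pairing (g v) x"]) (auto simp: gg)
  next
    case False
    define A where "A = (\<lambda>u. - pairing (g u) x) ` {u \<in> N. s u \<in> P}"
    define B where "B = (\<lambda>u. - pairing (g u) x) ` {u \<in> N. - s u \<in> P}"
    have "finite A" "finite B" using insert.prems(2) by (auto simp: A_def B_def N_def)
    moreover have "a < b" if ab: "a \<in> A" "b \<in> B" for a b
    proof -
      obtain u v where uv: "u \<in> N" "s u \<in> P" "a = - pairing (g u) x" "v \<in> N" "- s v \<in> P" "b = - pairing (g v) x"
        using ab unfolding A_def B_def by blast
      have "s v \<notin> P" using asym[of "s v"] uv by auto
      then have "g u - g v \<in> P" using lt uv by blast
      then show ?thesis using gg uv by simp
    qed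
    ultimately have "\<exists>c. (\<forall>a\<in>A. a < c) \<and> (\<forall>b\<in>B. c < b)" by (rule between_finite)
    then obtain c where c: "\<forall>a\<in>A. a < c" "\<forall>b\<in>B. c < b" by blast
    have 1: "0 < c + pairing (g u) x" if "u \<in> N" "s u \<in> P" for u
      using c(1) that add_strict_right_mono[of "- pairing (g u) x" c "pairing (g u) x"] by (auto simp: A_def)
    have 2: "c + pairing (g u) x < 0" if "u \<in> N" "- s u \<in> P" for u
      using c(2) that add_strict_right_mono[of c "- pairing (g u) x" "pairing (g u) x"] by (auto simp: B_def)
    \<comment> \<open>Here no \<open>s u\<close> is neutral, so the implications \<open>1\<close>
      and \<open>2\<close> are already equivalences.\<close>
    show ?thesis using 1 2 False by (intro exI[of _ c]) (meson less_asym)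
  qed
  then obtain c where c: "\<And>u. u \<in> N \<Longrightarrow> s u \<in> P \<longleftrightarrow> 0 < c + pairing (g u) x"
    "\<And>u. u \<in> N \<Longrightarrow> - s u \<in> P \<longleftrightarrow> c + pairing (g u) x < 0" by blast
  let ?y = "x + Poly_Mapping.single j c"
  have "?y \<in> fin_supp (insert j K)"
    using xK by (auto simp: fin_supp_iff lookup_add lookup_single when_def)
  moreover have "(u \<in> P \<longleftrightarrow> 0 < pairing u ?y) \<and> (- u \<in> P \<longleftrightarrow> pairing u ?y < 0)" if u: "u \<in> F" for u
  proof (cases "t u = 0")
    case True
    then have "u \<in> F'" using u by (simp add: F'_def)
    then show ?thesis using x True by (simp add: pairing_single_right t_def)
  next
    case False
    then have uN: "u \<in> N" using u by (simp add: N_def)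
    have "pairing (s u) ?y = pairing (s u) x + c"
      using insert.hyps(2) gK[of u]
      by (simp add: pairing_single_right s_def lookup_add e_def fin_supp_iff)
    also have "pairing e x = 0"
      using xK insert.hyps(2) by (simp add: e_def pairing_def fin_supp_iff)
    then have "pairing (s u) x = pairing (g u) x" by (simp add: s_def pairing_add_left)
    finally have su: "pairing (s u) ?y = c + pairing (g u) x" by (simp add: add.commute)
    have ueq: "u = scale_pm (t u) (s u)" using u_eq[OF u False] by (simp add: s_def)
    then have pu: "pairing u ?y = t u * (c + pairing (g u) x)" by (metis pairing_scale_left su)
    consider "t u > 0" | "- t u > 0" using False by (metis neg_0_less_iff_less neqE)
    then show ?thesis
    proof cases
      case 1
      have "u \<in> P \<longleftrightarrow> s u \<in> P" "- u \<in> P \<longleftrightarrow> - s u \<in> P"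
        using scale[of "s u" "t u"] scale[of "- s u" "t u"] 1 ueq by (simp_all add: scale_pm_simps)
      then show ?thesis using c[OF uN] 1 unfolding pu by (auto simp: zero_less_mult_iff mult_less_0_iff)
    next
      case 2
      have "u \<in> P \<longleftrightarrow> - s u \<in> P" "- u \<in> P \<longleftrightarrow> s u \<in> P"
        using scale[of "s u" "- t u"] scale[of "- s u" "- t u"] 2 ueq by (simp_all add: scale_pm_simps)
      then show ?thesis using c[OF uN] 2 unfolding pu by (auto simp: zero_less_mult_iff mult_less_0_iff)
    qed
  qed
  ultimately show ?case by blast
qed

section \<open>Lattice-valued preorders and homomorphisms\<close>

definition cone_valuation ::
  "('i \<Rightarrow>\<^sub>0 'k::{division_ring,linordered_ring_strict}) set \<Rightarrow> (('i \<Rightarrow>\<^sub>0 'k) \<Rightarrow> 'L::bounded_lattice_bot) \<Rightarrow> bool" where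
  "cone_valuation V p \<longleftrightarrow>
    (\<forall>a\<in>V. \<forall>b\<in>V. p (a + b) \<le> sup (p a) (p b)) \<and>
    (\<forall>a\<in>V. \<forall>c>0. p (scale_pm c a) = p a) \<and>
    (\<forall>a\<in>V. inf (p a) (p (- a)) = bot)"

lemma cone_valuationD:
  assumes "cone_valuation V p"
  shows "a \<in> V \<Longrightarrow> b \<in> V \<Longrightarrow> p (a + b) \<le> sup (p a) (p b)"
    "a \<in> V \<Longrightarrow> 0 < c \<Longrightarrow> p (scale_pm c a) = p a"
    "a \<in> V \<Longrightarrow> inf (p a) (p (- a)) = bot"
  using assms by (auto simp: cone_valuation_def)

text \<open>Composing \<open>p\<close> with the truth-valued homomorphism given by \<open>Q\<close>
  turns the laws of a valuation into those of a cone.\<close>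

lemma preorder_cone_prime_filter:
  assumes "cone_valuation V p" "prime_filter Q"
  shows "preorder_cone V {a. p a \<in> Q}"
proof -
  have "p a \<in> Q \<or> p b \<in> Q" if "a \<in> V" "b \<in> V" "p (a + b) \<in> Q" for a b
    using cone_valuationD(1)[OF assms(1) that(1,2)] that(3) prime_filterD[OF assms(2)]
    by (metis inf.absorb1)
  moreover have "p (- a) \<notin> Q" if "a \<in> V" "p a \<in> Q" for a
    using cone_valuationD(3)[OF assms(1) that(1)] that(2) prime_filterD[OF assms(2)] by metis
  ultimately show ?thesis
    using cone_valuationD(2)[OF assms(1)] by (auto simp: preorder_cone_def)
qed

text \<open>
  The value at \<open>X\<close> of the homomorphism is determined by requiring, for every prime filter \<open>Q\<close>, that it
  belong to \<open>Q\<close> iff \<open>X\<close> contains the points realizing the signs that \<open>Q\<close> gives to finitely many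
  functionals.
\<close>

lemma cone_valuation_hom:
  fixes p :: "('i \<Rightarrow>\<^sub>0 'k::{division_ring,linordered_ring_strict}) \<Rightarrow> 'L::{distrib_lattice,bounded_lattice_bot}"
  assumes p: "cone_valuation (fin_supp J) p"
  shows "\<exists>g. lattice_hom_on (Op_minus (fin_supp J) (fin_supp J)) g \<and>
    (\<forall>a\<in>fin_supp J. g (pos_half (fin_supp J) a) = p a)"
proof -
  let ?E = "fin_supp J :: ('i \<Rightarrow>\<^sub>0 'k) set"
  \<comment> \<open>Matching positivity is enough: a negative sign of \<open>u\<close> is tested by
    putting \<open>- u\<close> into \<open>F\<close>.\<close>
  define realizes where "realizes F x Q \<longleftrightarrow> x \<in> ?E \<and> prime_filter Q \<and> (\<forall>u\<in>F. p u \<in> Q \<longleftrightarrow> 0 < pairing u x)"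
    for F x Q
  \<comment> \<open>\<open>rel X l\<close> says that \<open>l\<close> is a correct value at
    \<open>X\<close>, as witnessed by a finite test set \<open>F\<close> of functionals.\<close>
  define rel where "rel X l \<longleftrightarrow> (\<exists>F\<subseteq>?E. finite F \<and> (\<forall>x Q. realizes F x Q \<longrightarrow> (l \<in> Q \<longleftrightarrow> x \<in> X)))"
    for X l
  have exists: "\<exists>x. realizes F x Q" if "finite F" "F \<subseteq> ?E" "prime_filter Q" for F Q
  proof -
    let ?K = "\<Union>u\<in>F. Poly_Mapping.keys u"
    have "finite ?K" "?K \<subseteq> J" "F \<subseteq> fin_supp ?K" using that by (auto simp: fin_supp_def)
    from preorder_cone_realized[OF preorder_cone_prime_filter[OF p that(3)] this(1,2) that(1) this(3)]
    obtain x where "x \<in> fin_supp ?K" "\<forall>u\<in>F. p u \<in> Q \<longleftrightarrow> 0 < pairing u x" by auto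
    moreover from this(1) \<open>?K \<subseteq> J\<close> have "x \<in> ?E" by (rule fin_supp_mono)
    ultimately show ?thesis using that(3) by (auto simp: realizes_def)
  qed
  have union: "realizes (F \<union> G) x Q \<Longrightarrow> realizes F x Q \<and> realizes G x Q" for F G x Q
    by (auto simp: realizes_def)
  \<comment> \<open>The union of two finite test sets is realized at every prime filter, so two
    correct values lie in the same prime filters.\<close>
  have unique: "l \<le> l'" if rels: "rel X l" "rel X l'" for X l l'
  proof -
    obtain F G where F: "F \<subseteq> ?E" "finite F" "\<And>x Q. realizes F x Q \<Longrightarrow> l \<in> Q \<longleftrightarrow> x \<in> X"
      and G: "G \<subseteq> ?E" "finite G" "\<And>x Q. realizes G x Q \<Longrightarrow> l' \<in> Q \<longleftrightarrow> x \<in> X"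
      using rels unfolding rel_def by metis
    have "l' \<in> Q" if Q: "prime_filter Q" "l \<in> Q" for Q
    proof -
      obtain x where "realizes (F \<union> G) x Q" using exists[of "F \<union> G" Q] F G Q(1) by auto
      then have "l \<in> Q \<longleftrightarrow> x \<in> X" "l' \<in> Q \<longleftrightarrow> x \<in> X" using F(3) G(3) union by blast+
      then show ?thesis using Q(2) by simp
    qed
    then show ?thesis by (simp add: le_iff_prime_filter)
  qed
  have pos: "rel (pos_half ?E a) (p a)" if "a \<in> ?E" for a
    unfolding rel_def using that by (intro exI[of _ "{a}"]) (auto simp: realizes_def pos_half_def)
  have neg: "rel (neg_half ?E a) (p (- a))" if "a \<in> ?E" for a
    unfolding rel_def using that
    by (intro exI[of _ "{- a}"]) (auto simp: realizes_def neg_half_def pairing_minus_left)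
  have lat: "rel (sup X Y) (sup l m) \<and> rel (inf X Y) (inf l m)" if rels: "rel X l" "rel Y m" for X Y l m
  proof -
    obtain F G where F: "F \<subseteq> ?E" "finite F" "\<And>x Q. realizes F x Q \<Longrightarrow> l \<in> Q \<longleftrightarrow> x \<in> X"
      and G: "G \<subseteq> ?E" "finite G" "\<And>x Q. realizes G x Q \<Longrightarrow> m \<in> Q \<longleftrightarrow> x \<in> Y"
      using rels unfolding rel_def by metis
    have "(sup l m \<in> Q \<longleftrightarrow> x \<in> sup X Y) \<and> (inf l m \<in> Q \<longleftrightarrow> x \<in> inf X Y)"
      if r: "realizes (F \<union> G) x Q" for x Q
    proof -
      have "prime_filter Q" using r by (simp add: realizes_def)
      moreover have "l \<in> Q \<longleftrightarrow> x \<in> X" "m \<in> Q \<longleftrightarrow> x \<in> Y" using F(3) G(3) union[OF r] by blast+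
      ultimately show ?thesis by (simp add: prime_filterD)
    qed
    moreover have "F \<union> G \<subseteq> ?E" "finite (F \<union> G)" using F G by auto
    ultimately show ?thesis unfolding rel_def by blast
  qed
  have total: "\<exists>l. rel X l" if "X \<in> Op_minus ?E ?E" for X
    using that unfolding Op_minus_def
    by (induction rule: gen_sublattice.induct) (use pos neg lat in blast)+
  define g where "g X = (SOME l. rel X l)" for X
  have g: "g X = l" if "rel X l" for X l
    unfolding g_def by (rule some_equality) (use that unique in \<open>blast intro: order.antisym\<close>)+
  have rel_g: "rel X (g X)" if "X \<in> Op_minus ?E ?E" for X using total[OF that] g by auto
  have "lattice_hom_on (Op_minus ?E ?E) g"
    unfolding lattice_hom_on_def using g lat[OF rel_g rel_g] by simp
  moreover have "\<forall>a\<in>?E. g (pos_half ?E a) = p a" using g[OF pos] by simp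
  ultimately show ?thesis by blast
qed

section \<open>Extending lattice-valued preorders\<close>

text \<open>A map is determined by its graph over its support, a finite subset of a countable
  product.\<close>

lemma countable_fin_supp:
  assumes "countable I" "countable (UNIV :: 'k::zero set)"
  shows "countable (fin_supp I :: ('i \<Rightarrow>\<^sub>0 'k) set)"
proof -
  let ?h = "\<lambda>y :: 'i \<Rightarrow>\<^sub>0 'k. (\<lambda>i. (i, Poly_Mapping.lookup y i)) ` Poly_Mapping.keys y"
  have "?h ` fin_supp I \<subseteq> {A. A \<subseteq> I \<times> UNIV \<and> finite A}" by (auto simp: fin_supp_def)
  moreover have "countable {A. A \<subseteq> I \<times> (UNIV :: 'k set) \<and> finite A}"
    using countable_Collect_finite_subset[of "I \<times> (UNIV :: 'k set)"] assms by (simp add: conj_commute)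
  ultimately have "countable (?h ` fin_supp I)" by (rule countable_subset)
  moreover have "inj_on ?h (fin_supp I)"
  proof (rule inj_onI, rule poly_mapping_eqI)
    fix x y i assume "?h x = ?h y"
    then have "(i, c) \<in> ?h x \<longleftrightarrow> (i, c) \<in> ?h y" for c by simp
    then have "Poly_Mapping.lookup x i = c \<and> c \<noteq> 0 \<longleftrightarrow> Poly_Mapping.lookup y i = c \<and> c \<noteq> 0" for c
      by (auto simp: image_iff in_keys_iff)
    then show "Poly_Mapping.lookup x i = Poly_Mapping.lookup y i" by metis
  qed
  ultimately show ?thesis by (rule countable_image_inj_on)
qed

text \<open>
  For a pair \<open>r\<close> of the prospective values at \<open>u + e\<close> and \<open>- u - e\<close>, where \<open>e\<close> is a new basis vector,
  the instances of subadditivity that relate it to the pair \<open>r'\<close> belonging to \<open>u'\<close>.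
\<close>

definition compatible where
  "compatible p u r u' r' \<longleftrightarrow>
    fst r \<le> sup (fst r') (p (u - u')) \<and> snd r \<le> sup (snd r') (p (u' - u)) \<and>
    p (u - u') \<le> sup (fst r) (snd r')"

text \<open>An instance of \<open>amalgamate_comparison\<close> with \<alpha>, \<beta> the
  components of \<open>f i\<close>, \<open>d i = p (v - w i)\<close> and
  \<open>e i = p (w i - v)\<close>: the new pair compares \<open>v\<close> with minus the new basis
  vector. The hypotheses come from the triangle inequality for \<open>p\<close> and the
  compatibility of the old pairs.\<close>

lemma compatible_extend:
  fixes p :: "('i \<Rightarrow>\<^sub>0 'k::{division_ring,linordered_ring_strict}) \<Rightarrow> 'L::completely_normal_lattice"
  assumes p: "cone_valuation (fin_supp I) p"
    and N: "finite N" "w ` N \<subseteq> fin_supp I" "v \<in> fin_supp I"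
    and f: "\<And>i. i \<in> N \<Longrightarrow> inf (fst (f i)) (snd (f i)) = bot"
      "\<And>i j. i \<in> N \<Longrightarrow> j \<in> N \<Longrightarrow> compatible p (w i) (f i) (w j) (f j)"
  shows "\<exists>r. inf (fst r) (snd r) = bot \<and>
    (\<forall>i\<in>N. compatible p v r (w i) (f i) \<and> compatible p (w i) (f i) v r)"
proof -
  have tri: "p (a - c) \<le> sup (p (a - b)) (p (b - c))"
    if "a \<in> fin_supp I" "b \<in> fin_supp I" "c \<in> fin_supp I" for a b c
    using cone_valuationD(1)[OF p, of "a - b" "b - c"] that by simp
  have "\<exists>x y. inf x y = bot \<and> (\<forall>i\<in>N.
    x \<le> sup (fst (f i)) (p (v - w i)) \<and> fst (f i) \<le> sup x (p (w i - v)) \<and> p (v - w i) \<le> sup x (snd (f i)) \<and>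
    y \<le> sup (snd (f i)) (p (w i - v)) \<and> snd (f i) \<le> sup y (p (v - w i)) \<and> p (w i - v) \<le> sup y (fst (f i)))"
  proof (rule amalgamate_comparison[OF N(1) f(1)])
    fix i assume i: "i \<in> N"
    then have "w i \<in> fin_supp I" using N by auto
    then show "inf (p (v - w i)) (p (w i - v)) = bot"
      using cone_valuationD(3)[OF p, of "v - w i"] N by simp
  next
    fix i j assume ij: "i \<in> N" "j \<in> N"
    then have W: "w i \<in> fin_supp I" "w j \<in> fin_supp I" using N by auto
    note c = f(2)[OF ij, unfolded compatible_def] f(2)[OF ij(2,1), unfolded compatible_def]
    show "p (v - w i) \<le> sup (sup (p (v - w j)) (fst (f j))) (snd (f i))"
      using tri[OF N(3) W(2,1)] c by (simp add: le_iff_prime_filter prime_filterD) blast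
    show "p (w j - v) \<le> sup (sup (p (w i - v)) (fst (f j))) (snd (f i))"
      using tri[OF W(2,1) N(3)] c by (simp add: le_iff_prime_filter prime_filterD) blast
    show "fst (f i) \<le> sup (sup (fst (f j)) (p (w i - v))) (p (v - w j))"
      using tri[OF W(1) N(3) W(2)] c by (simp add: le_iff_prime_filter prime_filterD) blast
    show "snd (f j) \<le> sup (sup (snd (f i)) (p (w i - v))) (p (v - w j))"
      using tri[OF W(1) N(3) W(2)] c by (simp add: le_iff_prime_filter prime_filterD) blast
  qed
  then obtain x y where "inf x y = bot" "\<forall>i\<in>N.
    x \<le> sup (fst (f i)) (p (v - w i)) \<and> fst (f i) \<le> sup x (p (w i - v)) \<and> p (v - w i) \<le> sup x (snd (f i)) \<and>
    y \<le> sup (snd (f i)) (p (w i - v)) \<and> snd (f i) \<le> sup y (p (v - w i)) \<and> p (w i - v) \<le> sup y (fst (f i))"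
    by blast
  then show ?thesis by (intro exI[of _ "(x, y)"]) (auto simp: compatible_def sup.commute)
qed

text \<open>Values are chosen along an enumeration of the functionals, each constrained only by the
  finitely many earlier ones. As \<open>0\<close> comes first, its value can be prescribed.\<close>

lemma compatible_family:
  fixes p :: "('i \<Rightarrow>\<^sub>0 'k::{division_ring,linordered_ring_strict}) \<Rightarrow> 'L::completely_normal_lattice"
  assumes p: "cone_valuation (fin_supp I) p"
    and "countable (fin_supp I :: ('i \<Rightarrow>\<^sub>0 'k) set)"
  shows "\<exists>A. A 0 = (l, bot) \<and> (\<forall>u\<in>fin_supp I. inf (fst (A u)) (snd (A u)) = bot) \<and>
    (\<forall>u\<in>fin_supp I. \<forall>v\<in>fin_supp I. compatible p u (A u) v (A v))"
proof -
  let ?W = "fin_supp I :: ('i \<Rightarrow>\<^sub>0 'k) set"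
  \<comment> \<open>The shift by one puts \<open>0\<close> at index 0; it may occur again
    later.\<close>
  define w where "w n = (case n of 0 \<Rightarrow> 0 | Suc m \<Rightarrow> from_nat_into ?W m)" for n
  have W: "?W \<noteq> {}" using fin_supp_closed(1)[of I] by blast
  have w: "w n \<in> ?W" for n using from_nat_into[OF W] by (simp add: w_def split: nat.split)
  have w_surj: "\<exists>n. w n = u" if "u \<in> ?W" for u
    using from_nat_into_surj[OF assms(2) that] by (metis nat.case(2) w_def)
  have p0: "p 0 = bot" using cone_valuationD(3)[OF p, of 0] by simp
  have refl: "compatible p u r u r" if "inf (fst r) (snd r) = bot" for u r
    by (simp add: compatible_def p0)
  \<comment> \<open>Both directions are demanded because \<open>compatible\<close> is not stated
    symmetrically.\<close>
  define good where "good f n r \<longleftrightarrow> inf (fst r) (snd r) = bot \<and> (n = 0 \<longrightarrow> r = (l, bot)) \<and>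
    (\<forall>i\<in>{..<n}. compatible p (w n) r (w i) (f i) \<and> compatible p (w i) (f i) (w n) r)"
    for f and n :: nat and r
  have compat: "compatible p (w i) (f i) (w j) (f j)" if "good f i (f i)" "good f j (f j)" for f i j
    using that refl unfolding good_def by (cases i j rule: linorder_cases) auto
  have "\<exists>f. \<forall>n. good f n (f n)"
  proof (rule dependent_wf_choice[OF wf_less_than])
    fix f g :: "nat \<Rightarrow> 'L \<times> 'L" and n r
    assume "\<And>m. (m, n) \<in> less_than \<Longrightarrow> f m = g m"
    then show "good f n r = good g n r" by (auto simp: good_def)
  next
    fix n and f :: "nat \<Rightarrow> 'L \<times> 'L"
    assume *: "\<And>m. (m, n) \<in> less_than \<Longrightarrow> good f m (f m)"
    show "\<exists>r. good f n r"
    proof (cases "n = 0")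
      case True
      then show ?thesis by (auto simp: good_def)
    next
      case False
      have "\<exists>r. inf (fst r) (snd r) = bot \<and> (\<forall>i\<in>{..<n}. compatible p (w n) r (w i) (f i) \<and> compatible p (w i) (f i) (w n) r)"
      proof (rule compatible_extend[OF p])
        fix i k assume "i \<in> {..<n}" "k \<in> {..<n}"
        then have "good f i (f i)" "good f k (f k)" using * by auto
        then show "compatible p (w i) (f i) (w k) (f k)" by (rule compat)
      next
        fix i assume "i \<in> {..<n}"
        then have "good f i (f i)" using * by auto
        then show "inf (fst (f i)) (snd (f i)) = bot" by (simp add: good_def)
      qed (use w in auto)
      then show ?thesis using False by (auto simp: good_def)
    qed
  qed
  then obtain f where f: "\<And>n. good f n (f n)" by blast
  \<comment> \<open>Taking the first index makes \<open>A 0\<close> the prescribed value even if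
    \<open>0\<close> is repeated.\<close>
  define A where "A u = f (LEAST n. w n = u)" for u
  have inv: "w (LEAST n. w n = u) = u" if "u \<in> ?W" for u using w_surj[OF that] by (rule LeastI_ex)
  have "(LEAST n. w n = 0) = 0" by (rule Least_eq_0) (simp add: w_def)
  then have "A 0 = (l, bot)" using f[of 0] by (simp add: A_def good_def)
  moreover have "inf (fst (A u)) (snd (A u)) = bot" for u using f by (simp add: A_def good_def)
  moreover have "compatible p u (A u) v (A v)" if "u \<in> ?W" "v \<in> ?W" for u v
    using compat[OF f f, of "LEAST n. w n = u" "LEAST n. w n = v"] inv that by (simp add: A_def)
  ultimately show ?thesis by blast
qed

lemma cone_valuation_insert:
  fixes p :: "('i \<Rightarrow>\<^sub>0 'k::{division_ring,linordered_ring_strict}) \<Rightarrow> 'L::completely_normal_lattice"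
  assumes p: "cone_valuation (fin_supp I) p"
    and cnt: "countable (fin_supp I :: ('i \<Rightarrow>\<^sub>0 'k) set)" and j: "j \<notin> I"
  shows "\<exists>q. cone_valuation (fin_supp (insert j I)) q \<and> (\<forall>a\<in>fin_supp I. q a = p a) \<and>
    q (Poly_Mapping.single j 1) = l"
proof -
  let ?W = "fin_supp I :: ('i \<Rightarrow>\<^sub>0 'k) set" and ?V = "fin_supp (insert j I) :: ('i \<Rightarrow>\<^sub>0 'k) set"
  obtain A where A0: "A 0 = (l, bot)" and disj: "\<And>u. u \<in> ?W \<Longrightarrow> inf (fst (A u)) (snd (A u)) = bot"
    and A: "\<And>u v. u \<in> ?W \<Longrightarrow> v \<in> ?W \<Longrightarrow> compatible p u (A u) v (A v)"
    using compatible_family[OF p cnt, of l] by blast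
  note A = A[unfolded compatible_def]
  define t where "t y = Poly_Mapping.lookup y j" for y :: "'i \<Rightarrow>\<^sub>0 'k"
  define b where "b y = restrict_pm I y" for y :: "'i \<Rightarrow>\<^sub>0 'k"
  define u where "u y = scale_pm (inverse (t y)) (b y)" for y
  \<comment> \<open>For \<open>t y \<noteq> 0\<close>, \<open>y\<close> is \<open>t y\<close> times
    \<open>u y\<close> plus the new basis vector. Positivity of \<open>y\<close> is therefore read
    off from the first component of \<open>A (u y)\<close> or, for negative \<open>t y\<close>, from
    the second.\<close>
  define q where "q y = (if t y = 0 then p y else if 0 < t y then fst (A (u y)) else snd (A (u y)))" for y
  have t: "t (x + y) = t x + t y" "t (- x) = - t x" "t (scale_pm c x) = c * t x" for x y c
    by (simp_all add: t_def lookup_add)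
  have b: "b (x + y) = b x + b y" "b (- x) = - b x" "b (scale_pm c x) = scale_pm c (b x)" for x y c
    by (auto intro!: poly_mapping_eqI simp: b_def lookup_restrict_pm lookup_add)
  have W: "b x \<in> ?W" "u x \<in> ?W" for x by (simp_all add: b_def u_def)
  have t0: "x \<in> ?W" "b x = x" if "x \<in> ?V" "t x = 0" for x
  proof -
    show "x \<in> ?W" using that by (auto simp: fin_supp_iff t_def)
    then show "b x = x" by (auto intro!: poly_mapping_eqI simp: b_def lookup_restrict_pm fin_supp_iff)
  qed
  have bu: "b x = scale_pm (t x) (u x)" if "t x \<noteq> 0" for x
    using that by (simp add: u_def scale_pm_simps)
  have pos: "p (scale_pm c x) = p x" if "x \<in> ?W" "0 < c" for c x
    using cone_valuationD(2)[OF p] that by blast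
  have neg: "p (scale_pm c x) = p (- x)" if "x \<in> ?W" "c < 0" for c x
    using pos[of "- x" "- c"] that by (simp add: scale_pm_simps)
  have inv: "inverse c < 0 \<longleftrightarrow> c < 0" "0 < inverse c \<longleftrightarrow> 0 < c" if "c \<noteq> 0" for c :: 'k
    using inverse_pos[of c] inverse_pos[of "- c"] that by (auto simp: neq_iff dest: less_asym)

  have add_W: "q (x + y) \<le> sup (q x) (q y)" if "x \<in> ?V" "y \<in> ?V" "t x \<noteq> 0" "t y = 0" for x y
  proof -
    have y: "y \<in> ?W" "b y = y" using t0 that by auto
    have uxy: "u (x + y) - u x = scale_pm (inverse (t x)) y"
      using that y by (simp add: u_def t b scale_pm_simps)
    show ?thesis
    proof (cases "0 < t x")
      case True
      then have "p (u (x + y) - u x) = p y" using uxy pos y inv that by simp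
      then show ?thesis using A[OF W(2) W(2), of "x + y" x] that True by (simp add: q_def t)
    next
      case False
      then have "p (- (u (x + y) - u x)) = p y"
        using uxy pos[of y "- inverse (t x)"] y inv[of "t x"] that by (simp add: scale_pm_simps)
      then show ?thesis using A[OF W(2) W(2), of "x + y" x] that False by (simp add: q_def t)
    qed
  qed
  \<comment> \<open>\<open>u (x + y)\<close> is an average of \<open>u x\<close> and
    \<open>u y\<close> with left weights summing to 1.\<close>
  have diff: "u (x + y) - u x = scale_pm (inverse (t x + t y) * t y) (u y - u x)"
    if "t x \<noteq> 0" "t y \<noteq> 0" "t x + t y \<noteq> 0" for x y
  proof -
    let ?s = "t x + t y"
    have "u x = scale_pm (inverse ?s * ?s) (u x)" using that by simp
    also have "\<dots> = scale_pm (inverse ?s * t x) (u x) + scale_pm (inverse ?s * t y) (u x)"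
      by (simp only: distrib_left scale_pm_simps)
    finally have 1: "u x = scale_pm (inverse ?s * t x) (u x) + scale_pm (inverse ?s * t y) (u x)" .
    have 2: "u (x + y) = scale_pm (inverse ?s * t x) (u x) + scale_pm (inverse ?s * t y) (u y)"
      by (simp only: u_def[of "x + y"] t b bu[OF that(1)] bu[OF that(2)] scale_pm_simps)
    show ?thesis by (subst 2, subst 1) (simp add: scale_pm_simps)
  qed
  have uu: "u x - u y \<in> ?W" for x y using W by simp
  \<comment> \<open>\<open>p (u x - u y)\<close> is below the join of \<open>q x\<close> and
    \<open>q y\<close>. If the coefficients cancel, \<open>x + y\<close> is a positive multiple of
    \<open>u x - u y\<close>. Otherwise one weight is negative, and the step from \<open>u x\<close>
    or \<open>u y\<close> to \<open>u (x + y)\<close> also has this value in the relevant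
    direction.\<close>
  have add_pos_neg: "q (x + y) \<le> sup (q x) (q y)" if "x \<in> ?V" "y \<in> ?V" "0 < t x" "t y < 0" for x y
  proof -
    have nz: "t x \<noteq> 0" "t y \<noteq> 0" using that by auto
    have qx: "q x = fst (A (u x))" and qy: "q y = snd (A (u y))" using that by (auto simp: q_def)
    have le: "p (u x - u y) \<le> sup (q x) (q y)" using A[OF W(2) W(2), of x y] by (simp add: qx qy)
    consider "t x + t y = 0" | "0 < t x + t y" | "t x + t y < 0" by (meson linorder_neqE)
    then show ?thesis
    proof cases
      case 1
      then have "t y = - t x" by (simp add: eq_neg_iff_add_eq_0 add.commute)
      then have "b (x + y) = scale_pm (t x) (u x - u y)"
        by (simp add: b bu nz scale_pm_simps)
      moreover have "b (x + y) = x + y" using 1 that by (intro t0) (simp_all add: t)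
      ultimately have "p (x + y) = p (u x - u y)" using pos[OF uu that(3)] by metis
      then show ?thesis using le 1 by (simp add: q_def[of "x + y"] t)
    next
      case 2
      then have "inverse (t x + t y) * t y < 0" using inverse_pos that(4) mult_pos_neg by blast
      then have "p (u (x + y) - u x) = p (u x - u y)"
        using diff[OF nz] 2 neg[OF uu] by simp
      moreover have "q (x + y) \<le> sup (q x) (p (u (x + y) - u x))"
        using A[OF W(2) W(2), of "x + y" x] 2 by (auto simp: q_def[of "x + y"] t qx)
      ultimately show ?thesis using le by (simp add: le_iff_prime_filter prime_filterD) blast
    next
      case 3
      then have "inverse (t y + t x) * t x < 0" using inv[of "t y + t x"] that(3)
        by (intro mult_neg_pos) (auto simp: add.commute)
      then have "p (- (u (x + y) - u y)) = p (u x - u y)"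
        using diff[of y x] nz 3 pos[OF uu, of "- (inverse (t y + t x) * t x)" x y]
        by (simp add: add.commute scale_pm_simps)
      moreover have "q (x + y) \<le> sup (q y) (p (- (u (x + y) - u y)))"
        using A[OF W(2) W(2), of "x + y" y] 3 by (auto simp: q_def[of "x + y"] t qy)
      ultimately show ?thesis using le by (simp add: le_iff_prime_filter prime_filterD) blast
    qed
  qed
  \<comment> \<open>Both weights are positive. Hence \<open>q (x + y)\<close> is below
    \<open>q x\<close> joined with one of \<open>p (u x - u y)\<close>, \<open>p (u y - u x)\<close>
    and below \<open>q y\<close> joined with the other; these two are disjoint.\<close>
  have add_same: "q (x + y) \<le> sup (q x) (q y)"
    if "x \<in> ?V" "y \<in> ?V" and sgn: "0 < t x \<and> 0 < t y \<or> t x < 0 \<and> t y < 0" for x y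
  proof -
    have nz: "t x \<noteq> 0" "t y \<noteq> 0" "t x + t y \<noteq> 0"
      and sum: "0 < t x + t y \<longleftrightarrow> 0 < t x" "0 < t y \<longleftrightarrow> 0 < t x"
      using sgn add_pos_pos[of "t x" "t y"] add_neg_neg[of "t x" "t y"] by auto
    have c: "0 < inverse (t x + t y) * t y" "0 < inverse (t y + t x) * t x"
      using sgn sum nz inv[OF nz(3)] add_neg_neg[of "t x" "t y"]
      by (auto simp: zero_less_mult_iff add.commute)
    have 1: "p (u (x + y) - u x) = p (u y - u x)" "p (u x - u (x + y)) = p (u x - u y)"
      using diff[OF nz] pos[OF uu c(1)] pos[OF uu c(1), of x y]
      by (simp, metis minus_diff_eq scale_pm_simps(3))
    have 2: "p (u (x + y) - u y) = p (u x - u y)" "p (u y - u (x + y)) = p (u y - u x)"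
      using diff[of y x] nz pos[OF uu c(2)] pos[OF uu c(2), of y x]
      by (simp add: add.commute, metis add.commute minus_diff_eq scale_pm_simps(3))
    have "inf (p (u x - u y)) (p (u y - u x)) = bot"
      using cone_valuationD(3)[OF p uu, of x y] by simp
    then show ?thesis
      using A[OF W(2) W(2), of "x + y" x] A[OF W(2) W(2), of "x + y" y] nz unfolding 1 2
      by (simp add: q_def t sum le_iff_prime_filter eq_bot_iff_prime_filter prime_filterD) blast
  qed
  have "q (x + y) \<le> sup (q x) (q y)" if "x \<in> ?V" "y \<in> ?V" for x y
  proof -
    consider "t x = 0" "t y = 0" | "t x \<noteq> 0" "t y = 0" | "t x = 0" "t y \<noteq> 0"
      | "0 < t x" "t y < 0" | "t x < 0" "0 < t y" | "0 < t x \<and> 0 < t y \<or> t x < 0 \<and> t y < 0"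
      by (meson linorder_neqE)
    then show ?thesis
    proof cases
      case 1
      then show ?thesis using cone_valuationD(1)[OF p, of x y] t0 that by (simp add: q_def t)
    next
      case 3
      then show ?thesis using add_W[of y x] that by (simp add: ac_simps)
    next
      case 5
      then show ?thesis using add_pos_neg[of y x] that by (simp add: ac_simps)
    qed (use that add_W add_pos_neg add_same in blast)+
  qed
  moreover have "q (scale_pm c x) = q x" if "x \<in> ?V" "0 < c" for c x
  proof -
    have "u (scale_pm c x) = u x" if "t x \<noteq> 0"
      using that \<open>0 < c\<close> by (simp add: u_def t b scale_pm_simps nonzero_inverse_mult_distrib mult.assoc)
    moreover have "0 < c * t x \<longleftrightarrow> 0 < t x" using \<open>0 < c\<close> by (auto simp: zero_less_mult_iff)
    ultimately show ?thesis using that t0[of x] pos[of x c] by (auto simp: q_def t)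
  qed
  moreover have "inf (q x) (q (- x)) = bot" if "x \<in> ?V" for x
  proof -
    have "u (- x) = u x" if "t x \<noteq> 0"
      using that by (simp add: u_def t b scale_pm_simps)
    then show ?thesis using that disj[OF W(2), of x] cone_valuationD(3)[OF p, of x] t0[of x]
      by (auto simp: q_def t inf.commute)
  qed
  ultimately have "cone_valuation ?V q" by (auto simp: cone_valuation_def)
  moreover have "q a = p a" if "a \<in> ?W" for a using that j by (auto simp: q_def t_def fin_supp_iff)
  \<comment> \<open>The new basis vector has coefficient 1 and old part \<open>0\<close>, so its
    value is the first component of \<open>A 0\<close>.\<close>
  moreover have "q (Poly_Mapping.single j 1) = l"
  proof -
    have "b (Poly_Mapping.single j 1) = 0"
      using j by (auto intro!: poly_mapping_eqI simp: b_def lookup_restrict_pm lookup_single when_def)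
    then show ?thesis by (simp add: q_def t_def u_def scale_pm_simps A0 zero_less_one_ring)
  qed
  ultimately show ?thesis by blast
qed

section \<open>Adjoining countably many basis vectors\<close>

lemma fin_supp_UN_mono:
  fixes I :: "nat \<Rightarrow> 'i set"
  assumes "mono I" "y \<in> fin_supp (\<Union>n. I n)"
  shows "\<exists>n. y \<in> fin_supp (I n)"
proof -
  have "\<exists>n. K \<subseteq> I n" if "finite K" "K \<subseteq> (\<Union>n. I n)" for K
    using that
  proof (induction K)
    case (insert k K)
    then obtain m n where "K \<subseteq> I m" "k \<in> I n" by auto
    moreover have "I m \<subseteq> I (max m n)" "I n \<subseteq> I (max m n)" using assms(1) by (simp_all add: monoD)
    ultimately show ?case by blast
  qed auto
  then show ?thesis using assms(2) by (auto simp: fin_supp_def)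
qed

text \<open>The vectors indexed by \<open>j n\<close> are adjoined one at a time. Each law involves
  only finitely many functionals, so it can be checked at a finite stage.\<close>

lemma cone_valuation_extend:
  fixes p :: "('i \<Rightarrow>\<^sub>0 'k::{division_ring,linordered_ring_strict}) \<Rightarrow> 'L::completely_normal_lattice"
  assumes "countable (UNIV :: 'k set)" "countable I" and p: "cone_valuation (fin_supp I) p"
    and j: "inj j" "range j = J - I" and "I \<subseteq> J"
  shows "\<exists>q. cone_valuation (fin_supp J) q \<and> (\<forall>a\<in>fin_supp I. q a = p a) \<and>
    (\<forall>n :: nat. q (Poly_Mapping.single (j n) 1) = l n)"
proof -
  define K where "K n = I \<union> j ` {..<n}" for n :: nat
  define W where "W n = (fin_supp (K n) :: ('i \<Rightarrow>\<^sub>0 'k) set)" for n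
  have KSuc: "K (Suc n) = insert (j n) (K n)" for n by (auto simp: K_def lessThan_Suc)
  have jK: "j n \<notin> K n" for n using j by (auto simp: K_def dest: injD)
  have mono: "mono K" by (intro monoI) (auto simp: K_def)
  have W_mono: "a \<in> W n" if "a \<in> W m" "m \<le> n" for a m n
    using that monoD[OF mono that(2)] unfolding W_def by (auto intro: fin_supp_mono)
  have UN: "(\<Union>n. K n) = J" using j \<open>I \<subseteq> J\<close> by (auto simp: K_def)
  have "\<exists>Q. \<forall>n. (cone_valuation (W n) (Q n) \<and> (n = 0 \<longrightarrow> Q n = p)) \<and>
      ((\<forall>a\<in>W n. Q (Suc n) a = Q n a) \<and> Q (Suc n) (Poly_Mapping.single (j n) 1) = l n)"
  proof (rule dependent_nat_choice)
    show "\<exists>q. cone_valuation (W 0) q \<and> (0 = 0 \<longrightarrow> q = p)" using p by (simp add: W_def K_def)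
  next
    fix q n assume "cone_valuation (W n) q \<and> (n = 0 \<longrightarrow> q = p)"
    moreover have "countable (W n)"
      unfolding W_def using assms(1,2) by (intro countable_fin_supp) (auto simp: K_def)
    ultimately have "\<exists>q'. cone_valuation (W (Suc n)) q' \<and> (\<forall>a\<in>W n. q' a = q a) \<and>
        q' (Poly_Mapping.single (j n) 1) = l n"
      unfolding W_def KSuc using jK by (intro cone_valuation_insert) auto
    then show "\<exists>q'. (cone_valuation (W (Suc n)) q' \<and> (Suc n = 0 \<longrightarrow> q' = p)) \<and>
        (\<forall>a\<in>W n. q' a = q a) \<and> q' (Poly_Mapping.single (j n) 1) = l n"
      by blast
  qed
  then obtain Q where Q: "\<And>n. cone_valuation (W n) (Q n)" "Q 0 = p"
    and Suc: "\<And>n a. a \<in> W n \<Longrightarrow> Q (Suc n) a = Q n a"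
    and l: "\<And>n. Q (Suc n) (Poly_Mapping.single (j n) 1) = l n"
    by blast
  have agree: "Q n a = Q m a" if "m \<le> n" "a \<in> W m" for m n a
    using that by (induction rule: dec_induct) (auto simp: Suc W_mono)
  \<comment> \<open>The first stage containing \<open>a\<close> is used; by \<open>agree\<close> all
    later stages give the same value.\<close>
  define q where "q a = Q (LEAST n. a \<in> W n) a" for a
  have q: "q a = Q n a" if "a \<in> W n" for a n
    using agree[of "LEAST n. a \<in> W n" n a] LeastI[of "\<lambda>n. a \<in> W n", OF that]
      Least_le[of "\<lambda>n. a \<in> W n", OF that] by (simp add: q_def)
  have in_W: "\<exists>n. a \<in> W n" if "a \<in> fin_supp J" for a
    using fin_supp_UN_mono[OF mono] that unfolding UN W_def by blast
  have "q (a + b) \<le> sup (q a) (q b)" if J: "a \<in> fin_supp J" "b \<in> fin_supp J" for a b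
  proof -
    obtain m n where "a \<in> W m" "b \<in> W n" using in_W[OF J(1)] in_W[OF J(2)] by blast
    then have ab: "a \<in> W (max m n)" "b \<in> W (max m n)" using W_mono by auto
    then have "a + b \<in> W (max m n)" by (simp add: W_def)
    then show ?thesis using cone_valuationD(1)[OF Q(1) ab] ab q by simp
  qed
  \<comment> \<open>The alternative \<open>c = 1\<close> provides an instance for the disjointness
    law, in which no scalar occurs.\<close>
  moreover have "q (scale_pm c a) = q a \<and> inf (q a) (q (- a)) = bot"
    if J: "a \<in> fin_supp J" and c: "0 < c \<or> c = 1" for a c
  proof -
    obtain n where n: "a \<in> W n" using in_W[OF J] by blast
    then have "scale_pm c a \<in> W n" "- a \<in> W n" by (simp_all add: W_def)
    then show ?thesis using cone_valuationD(2,3)[OF Q(1) n] n q c by auto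
  qed
  ultimately have "cone_valuation (fin_supp J) q" by (auto simp: cone_valuation_def)
  moreover have "q a = p a" if "a \<in> fin_supp I" for a
    using q[of a 0] that by (simp add: W_def K_def Q(2))
  moreover have "q (Poly_Mapping.single (j n) 1) = l n" for n
    using q[of "Poly_Mapping.single (j n) 1" "Suc n"] l
    by (auto simp: W_def KSuc fin_supp_iff lookup_single when_def)
  ultimately show ?thesis by blast
qed

section \<open>The extension theorem\<close>

lemma neg_half_eq: "neg_half E a = pos_half E (- a)"
  by (auto simp: neg_half_def pos_half_def pairing_minus_left)

text \<open>The laws are images under \<open>h\<close> of facts on half-spaces: a positive sum has a
  positive summand, positive scaling changes nothing, and \<open>a\<close> and \<open>- a\<close>
  are never both positive.\<close>

lemma cone_valuation_of_hom:
  fixes h :: "('i \<Rightarrow>\<^sub>0 'k::{division_ring,linordered_ring_strict}) set \<Rightarrow> 'L::bounded_lattice_bot"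
  assumes h: "lattice0_hom_on (Op_minus (fin_supp I) (fin_supp I)) h"
  shows "cone_valuation (fin_supp I) (\<lambda>a. h (pos_half (fin_supp I) a))"
proof -
  let ?E = "fin_supp I :: ('i \<Rightarrow>\<^sub>0 'k) set"
  have Op: "pos_half ?E a \<in> Op_minus ?E ?E" if "a \<in> ?E" for a
    using that unfolding Op_minus_def by (intro gen_sublattice.gen) blast
  have sup: "h (X \<union> Y) = sup (h X) (h Y)" and inf: "h (X \<inter> Y) = inf (h X) (h Y)"
    if "X \<in> Op_minus ?E ?E" "Y \<in> Op_minus ?E ?E" for X Y
    using h that by (auto simp: lattice0_hom_on_def lattice_hom_on_def)
  have "h (pos_half ?E (a + b)) \<le> sup (h (pos_half ?E a)) (h (pos_half ?E b))" if "a \<in> ?E" "b \<in> ?E" for a b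
  proof -
    \<comment> \<open>The inclusion is written as an equation in the lattice so that
      \<open>h\<close> carries it over.\<close>
    have "pos_half ?E (a + b) \<inter> (pos_half ?E a \<union> pos_half ?E b) = pos_half ?E (a + b)"
      by (auto simp: pos_half_def pairing_add_left not_less dest: add_nonpos_nonpos)
        (meson add_nonpos_nonpos not_le)
    moreover have "pos_half ?E a \<union> pos_half ?E b \<in> Op_minus ?E ?E"
      using gen_sublattice.sup Op that unfolding Op_minus_def by blast
    ultimately have "h (pos_half ?E (a + b)) = inf (h (pos_half ?E (a + b))) (sup (h (pos_half ?E a)) (h (pos_half ?E b)))"
      using sup inf Op that by (metis fin_supp_closed(2))
    then show ?thesis by (metis inf.cobounded2)
  qed
  moreover have "pos_half ?E (scale_pm c a) = pos_half ?E a" if "0 < c" for c a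
    using that by (auto simp: pos_half_def pairing_scale_left zero_less_mult_iff dest: less_asym)
  moreover have "inf (h (pos_half ?E a)) (h (pos_half ?E (- a))) = bot" if "a \<in> ?E" for a
  proof -
    have "pos_half ?E a \<inter> pos_half ?E (- a) = {}" by (auto simp: pos_half_def pairing_minus_left)
    then show ?thesis using inf[of "pos_half ?E a" "pos_half ?E (- a)"] Op that h
      by (simp add: lattice0_hom_on_def)
  qed
  ultimately show ?thesis by (auto simp: cone_valuation_def)
qed

lemma eps_pos_half:
  assumes "a \<in> fin_supp I"
  shows "eps I J (pos_half (fin_supp I) a) = pos_half (fin_supp J) a"
  using pairing_restrict[OF assms] by (auto simp: eps_def pos_half_def)

theorem theorem7p1:
  fixes I J :: "'i set"
    and \<phi> :: "'K::{distrib_lattice,bounded_lattice_bot} \<Rightarrow> 'L::completely_normal_lattice"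
    and f :: "('i \<Rightarrow>\<^sub>0 'k::{division_ring,linordered_ring_strict}) set \<Rightarrow> 'K"
  assumes "countable (UNIV :: 'k set)"
    and "countable I" and "countable J" and "I \<subset> J" and "infinite (J - I)"
    and "countable (UNIV :: 'L set)"
    and "lattice0_hom_on UNIV \<phi>"
    and "lattice0_hom_on (Op_minus (fin_supp I) (fin_supp I)) f"
  shows "\<exists>g :: ('i \<Rightarrow>\<^sub>0 'k) set \<Rightarrow> 'L.
    lattice_hom_on (Op_minus (fin_supp J) (fin_supp J)) g \<and>
    g ` Op_minus (fin_supp J) (fin_supp J) = UNIV \<and>
    (\<forall>X \<in> Op_minus (fin_supp I) (fin_supp I). g (eps I J X) = \<phi> (f X))"
proof -
  let ?E = "fin_supp I :: ('i \<Rightarrow>\<^sub>0 'k) set" and ?F = "fin_supp J :: ('i \<Rightarrow>\<^sub>0 'k) set"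
  let ?h = "\<lambda>X. \<phi> (f X)"
  have h: "lattice0_hom_on (Op_minus ?E ?E) ?h"
    using assms(7,8) by (simp add: lattice0_hom_on_def lattice_hom_on_def)
  define j where "j = from_nat_into (J - I)"
  have bij: "bij_betw j UNIV (J - I)"
    unfolding j_def using assms(3,5) by (intro bij_betw_from_nat_into) auto
  define l where "l = from_nat_into (UNIV :: 'L set)"
  have "range l = UNIV" unfolding l_def using assms(6) by (intro range_from_nat_into) auto
  have "\<exists>q. cone_valuation ?F q \<and> (\<forall>a\<in>?E. q a = ?h (pos_half ?E a)) \<and>
      (\<forall>n. q (Poly_Mapping.single (j n) 1) = l n)"
    using cone_valuation_extend[OF assms(1,2) cone_valuation_of_hom[OF h], of j J l] bij assms(4)
    by (auto simp: bij_betw_def)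
  then obtain q where q: "cone_valuation ?F q" "\<And>a. a \<in> ?E \<Longrightarrow> q a = ?h (pos_half ?E a)"
    "\<And>n. q (Poly_Mapping.single (j n) 1) = l n" by blast
  obtain g where g: "lattice_hom_on (Op_minus ?F ?F) g" "\<And>a. a \<in> ?F \<Longrightarrow> g (pos_half ?F a) = q a"
    using cone_valuation_hom[OF q(1)] by blast
  \<comment> \<open>The half-spaces of the new basis vectors alone already reach every
    \<open>l n\<close>, hence all of \<open>L\<close>.\<close>
  have "x \<in> g ` Op_minus ?F ?F" for x
  proof -
    obtain n where "x = l n" using \<open>range l = UNIV\<close> by blast
    moreover have "Poly_Mapping.single (j n) 1 \<in> ?F"
      using bij_betwE[OF bij] by (auto simp: fin_supp_iff lookup_single when_def)
    moreover from this have "pos_half ?F (Poly_Mapping.single (j n) 1) \<in> Op_minus ?F ?F"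
      unfolding Op_minus_def by (intro gen_sublattice.gen) blast
    ultimately show ?thesis using g(2) q(3) by (metis imageI)
  qed
  \<comment> \<open>Both sides respect unions and intersections, so agreement on the generating
    half-spaces suffices; negative ones are positive ones of \<open>- a\<close>.\<close>
  moreover have "g (eps I J X) = ?h X" if "X \<in> Op_minus ?E ?E" for X
    using that unfolding Op_minus_def
  proof (induction rule: gen_sublattice.induct)
    case (gen X)
    then obtain a where a: "a \<in> ?E" "X = pos_half ?E a"
      unfolding neg_half_eq using fin_supp_closed_ring(1) by blast
    then have "a \<in> ?F" using assms(4) by (auto intro: fin_supp_mono)
    then show ?case using a g(2) q(2) by (simp add: eps_pos_half)
  next
    case (sup X Y)
    have "eps I J X \<in> Op_minus ?F ?F" "eps I J Y \<in> Op_minus ?F ?F"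
      using sup assms(4) by (auto simp: Op_minus_def intro!: eps_Op_minus[unfolded Op_minus_def])
    moreover have "eps I J (X \<union> Y) = eps I J X \<union> eps I J Y" by (auto simp: eps_def)
    ultimately show ?case
      using sup g(1) h by (simp add: lattice0_hom_on_def lattice_hom_on_def Op_minus_def)
  next
    case (inf X Y)
    have "eps I J X \<in> Op_minus ?F ?F" "eps I J Y \<in> Op_minus ?F ?F"
      using inf assms(4) by (auto simp: Op_minus_def intro!: eps_Op_minus[unfolded Op_minus_def])
    moreover have "eps I J (X \<inter> Y) = eps I J X \<inter> eps I J Y" by (auto simp: eps_def)
    ultimately show ?case
      using inf g(1) h by (simp add: lattice0_hom_on_def lattice_hom_on_def Op_minus_def)
  qed
  ultimately show ?thesis using g(1) by blast
qed

end
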